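(* Let $A$ be a $\mathbb{K}$-brace endowed with a descending ideal filtration with zero intersection. Then the associated graded structure of the brace $A$ is a pre-Lie algebra over $\mathbb{K}$.
   Context: $\mathbb{K}$ is a field. A brace is a set $A$ with operations $+$ and $*$ such that $(A,+)$ is an abelian group, $(A,\circ)$ is a group where $a\circ b=a+b+a*b$, and the identity $(a*b+a+b)*c=a*c+b*c+a*(b*c)$ holds; left distributivity $a*(b+c)=a*b+a*c$ also holds. A $\mathbb{K}$-brace is a brace whose additive group is a $\mathbb{K}$-vector space with $a*(\lambda b)=\lambda(a*b)$ for $\lambda\in\mathbb{K}$. An ideal $I$ of $A$ is a subgroup (for a $\mathbb{K}$-brace, a $\mathbb{K}$-subspace) of $(A,+)$ with $A*I\subseteq I$ and $I*A\subseteq I$. A descending ideal filtration with zero intersection is a family of ideals $A_i$, $i\ge1$, with $A=\bigcup_i A_i$, $A_{i+1}\subset A_i$, $A_i*A_j\subset A_{i+j}$, and $\bigcap_{i=1}^{\infty}A_i=0$. The associated graded structure is $A_{gr}=\bigoplus_{i\ge1}A_i/A_{i+1}$ with multiplication given on homogeneous elements by $(a+A_{i+1})*(b+A_{j+1})=a*b+A_{i+j+1}$ for $a\in A_i$, $b\in A_j$, extended to all of $A_{gr}$ by left and right distributivity. A pre-Lie algebra is an algebra with one binary (nonassociative) product $\cdot$ whose associator $(a,b,c)=(a\cdot b)\cdot c-a\cdot(b\cdot c)$ satisfies $(a,b,c)=(b,a,c)$ for all $a,b,c$.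
   Formalization: A K-bilinear product can fail (on C×C, (v,w)*(v',w')=(0,conj(v)v')); proved: A_gr is left-symmetric, biadditive, K-linear in the second argument, and a pre-Lie algebra over K iff (ka)*b-k(a*b) is in A_{i+j+1} for all k in K, a in A_i, b in A_j. *)

theory Defs
  imports "HOL-Algebra.Algebra"
begin

text \<open>
  Braces, pre-Lie algebras and the associated graded structure all live in the library record
  of modules: \<open>\<oplus>\<close> is the addition, the ring multiplication \<open>\<otimes>\<close> is the (nonassociative)
  operation \<open>*\<close>, and \<open>\<odot>\<close> is the action of the field. The component \<open>\<one>\<close> is never used.
\<close>

definition circ :: "('a, 'm) ring_scheme \<Rightarrow> 'a \<Rightarrow> 'a \<Rightarrow> 'a" where
  "circ A a b = a \<oplus>\<^bsub>A\<^esub> b \<oplus>\<^bsub>A\<^esub> a \<otimes>\<^bsub>A\<^esub> b"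

text \<open>
  The neutral element of \<open>\<circ>\<close> is forced to be \<open>\<zero>\<close>: left distributivity gives
  \<open>a * 0 = 0\<close>, hence \<open>a \<circ> 0 = a\<close> for all \<open>a\<close>.
\<close>
definition circ_group :: "('a, 'm) ring_scheme \<Rightarrow> 'a monoid" where
  "circ_group A = \<lparr>carrier = carrier A, monoid.mult = circ A, one = \<zero>\<^bsub>A\<^esub>\<rparr>"

locale brace = abelian_group A for A (structure) +
  assumes star_closed: "\<lbrakk>a \<in> carrier A; b \<in> carrier A\<rbrakk> \<Longrightarrow> a \<otimes> b \<in> carrier A"
    and group_circ: "group (circ_group A)"
    and star_left_distrib:
      "\<lbrakk>a \<in> carrier A; b \<in> carrier A; c \<in> carrier A\<rbrakk> \<Longrightarrow> a \<otimes> (b \<oplus> c) = a \<otimes> b \<oplus> a \<otimes> c"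
    and star_circ:
      "\<lbrakk>a \<in> carrier A; b \<in> carrier A; c \<in> carrier A\<rbrakk> \<Longrightarrow>
        (a \<otimes> b \<oplus> a \<oplus> b) \<otimes> c = a \<otimes> c \<oplus> b \<otimes> c \<oplus> a \<otimes> (b \<otimes> c)"

locale K_brace = field K + module K A + brace A for K (structure) and A (structure) +
  assumes star_smult:
    "\<lbrakk>k \<in> carrier K; a \<in> carrier A; b \<in> carrier A\<rbrakk> \<Longrightarrow>
      a \<otimes>\<^bsub>A\<^esub> (k \<odot>\<^bsub>A\<^esub> b) = k \<odot>\<^bsub>A\<^esub> (a \<otimes>\<^bsub>A\<^esub> b)"

definition K_brace_ideal ::
    "('k, 'm) ring_scheme \<Rightarrow> ('k, 'a, 'n) module_scheme \<Rightarrow> 'a set \<Rightarrow> bool" where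
  "K_brace_ideal K A I \<longleftrightarrow> submodule I K A \<and>
     (\<forall>a\<in>carrier A. \<forall>x\<in>I. a \<otimes>\<^bsub>A\<^esub> x \<in> I \<and> x \<otimes>\<^bsub>A\<^esub> a \<in> I)"

text \<open>The filtration is indexed from 1; the value of \<open>F\<close> at 0 is irrelevant.\<close>
definition descending_ideal_filtration ::
    "('k, 'm) ring_scheme \<Rightarrow> ('k, 'a, 'n) module_scheme \<Rightarrow> (nat \<Rightarrow> 'a set) \<Rightarrow> bool" where
  "descending_ideal_filtration K A F \<longleftrightarrow>
     (\<forall>i\<ge>1. K_brace_ideal K A (F i)) \<and>
     carrier A = (\<Union>i\<in>{1..}. F i) \<and>
     (\<forall>i\<ge>1. F (i + 1) \<subseteq> F i) \<and>
     (\<forall>i\<ge>1. \<forall>j\<ge>1. \<forall>a\<in>F i. \<forall>b\<in>F j. a \<otimes>\<^bsub>A\<^esub> b \<in> F (i + j)) \<and>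
     (\<Inter>i\<in>{1..}. F i) = {\<zero>\<^bsub>A\<^esub>}"

text \<open>The additive quotient \<open>A\<^sub>i / A\<^sub>i\<^sub>+\<^sub>1\<close>, in the library's multiplicative notation for quotients.\<close>
definition gr_component ::
    "('k, 'a, 'n) module_scheme \<Rightarrow> (nat \<Rightarrow> 'a set) \<Rightarrow> nat \<Rightarrow> 'a set monoid" where
  "gr_component A F i = (A\<lparr>carrier := F i\<rparr>) A_Mod F (i + 1)"

text \<open>
  The additive group of \<open>gr A F\<close> is the direct sum of these quotients. As with the library's
  \<^const>\<open>rcoset_mult\<close>, the operations on cosets are unions over all representatives, so each is
  a single coset exactly when it does not depend on the representatives. The product of two
  homogeneous cosets of degrees \<open>i\<close> and \<open>j\<close> is \<open>(a + A\<^sub>i\<^sub>+\<^sub>1) * (b + A\<^sub>j\<^sub>+\<^sub>1) = a * b + A\<^sub>i\<^sub>+\<^sub>j\<^sub>+\<^sub>1\<close>;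
  the component of degree \<open>n\<close> of a general product is the sum of these over \<open>i + j = n\<close>.
\<close>
definition gr ::
    "('k, 'a, 'n) module_scheme \<Rightarrow> (nat \<Rightarrow> 'a set) \<Rightarrow> ('k, nat \<Rightarrow> 'a set) module" where
  "gr A F =
    (let S = sum_group {1..} (gr_component A F) in
     \<lparr>carrier = carrier S,
      monoid.mult = (\<lambda>x y. \<lambda>n\<in>{1..}. finprod (gr_component A F n)
        (\<lambda>i. rcoset_mult A (F (n + 1)) (x i) (y (n - i))) {1..<n}),
      one = undefined,
      ring.zero = \<one>\<^bsub>S\<^esub>,
      ring.add = (\<lambda>x y. x \<otimes>\<^bsub>S\<^esub> y),
      smult = (\<lambda>k x. \<lambda>n\<in>{1..}. \<Union>a\<in>x n. F (n + 1) +>\<^bsub>A\<^esub> (k \<odot>\<^bsub>A\<^esub> a))\<rparr>)"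

text \<open>The homogeneous element \<open>a + A\<^sub>i\<^sub>+\<^sub>1\<close> of degree \<open>i\<close>, for \<open>a \<in> A\<^sub>i\<close>.\<close>
definition gr_hom ::
    "('k, 'a, 'n) module_scheme \<Rightarrow> (nat \<Rightarrow> 'a set) \<Rightarrow> nat \<Rightarrow> 'a \<Rightarrow> nat \<Rightarrow> 'a set" where
  "gr_hom A F i a = (\<lambda>n\<in>{1..}. if n = i then F (i + 1) +>\<^bsub>A\<^esub> a else F (n + 1))"

definition associator :: "('a, 'm) ring_scheme \<Rightarrow> 'a \<Rightarrow> 'a \<Rightarrow> 'a \<Rightarrow> 'a" where
  "associator L a b c = ((a \<otimes>\<^bsub>L\<^esub> b) \<otimes>\<^bsub>L\<^esub> c) \<ominus>\<^bsub>L\<^esub> (a \<otimes>\<^bsub>L\<^esub> (b \<otimes>\<^bsub>L\<^esub> c))"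

text \<open>
  The \<open>K\<close>-linearity of the product is required in the second argument only, as in the
  definition of a \<open>K\<close>-brace; in the first argument the product is merely additive.
\<close>
locale right_linear_pre_lie_algebra = field K + module K L for K (structure) and L (structure) +
  assumes prod_closed: "\<lbrakk>a \<in> carrier L; b \<in> carrier L\<rbrakk> \<Longrightarrow> a \<otimes>\<^bsub>L\<^esub> b \<in> carrier L"
    and prod_left_distrib:
      "\<lbrakk>a \<in> carrier L; b \<in> carrier L; c \<in> carrier L\<rbrakk> \<Longrightarrow>
        a \<otimes>\<^bsub>L\<^esub> (b \<oplus>\<^bsub>L\<^esub> c) = a \<otimes>\<^bsub>L\<^esub> b \<oplus>\<^bsub>L\<^esub> a \<otimes>\<^bsub>L\<^esub> c"
    and prod_right_distrib:
      "\<lbrakk>a \<in> carrier L; b \<in> carrier L; c \<in> carrier L\<rbrakk> \<Longrightarrow>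
        (a \<oplus>\<^bsub>L\<^esub> b) \<otimes>\<^bsub>L\<^esub> c = a \<otimes>\<^bsub>L\<^esub> c \<oplus>\<^bsub>L\<^esub> b \<otimes>\<^bsub>L\<^esub> c"
    and prod_smult_right:
      "\<lbrakk>k \<in> carrier K; a \<in> carrier L; b \<in> carrier L\<rbrakk> \<Longrightarrow>
        a \<otimes>\<^bsub>L\<^esub> (k \<odot>\<^bsub>L\<^esub> b) = k \<odot>\<^bsub>L\<^esub> (a \<otimes>\<^bsub>L\<^esub> b)"
    and associator_left_symmetric:
      "\<lbrakk>a \<in> carrier L; b \<in> carrier L; c \<in> carrier L\<rbrakk> \<Longrightarrow>
        associator L a b c = associator L b a c"

locale pre_lie_algebra = right_linear_pre_lie_algebra +
  assumes prod_smult_left: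
    "\<lbrakk>k \<in> carrier K; a \<in> carrier L; b \<in> carrier L\<rbrakk> \<Longrightarrow>
      (k \<odot>\<^bsub>L\<^esub> a) \<otimes>\<^bsub>L\<^esub> b = k \<odot>\<^bsub>L\<^esub> (a \<otimes>\<^bsub>L\<^esub> b)"

text \<open>
  In a \<open>K\<close>-brace \<open>(k a) * b = k (a * b)\<close> may fail, and the failure can survive in the graded
  structure: on \<open>\<complex> \<times> \<complex>\<close> let \<open>(v, w) * (v', w') = (0, cnj v v')\<close>, filtered by
  \<open>A\<^sub>1 = \<complex> \<times> \<complex>\<close>, \<open>A\<^sub>2 = 0 \<times> \<complex>\<close>, \<open>A\<^sub>3 = 0\<close>. The following condition says that it does
  not survive. This holds over every prime field.
\<close>
definition graded_left_homogeneous ::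
    "('k, 'm) ring_scheme \<Rightarrow> ('k, 'a, 'n) module_scheme \<Rightarrow> (nat \<Rightarrow> 'a set) \<Rightarrow> bool" where
  "graded_left_homogeneous K A F \<longleftrightarrow>
     (\<forall>k\<in>carrier K. \<forall>i\<ge>1. \<forall>j\<ge>1. \<forall>a\<in>F i. \<forall>b\<in>F j.
        (k \<odot>\<^bsub>A\<^esub> a) \<otimes>\<^bsub>A\<^esub> b \<ominus>\<^bsub>A\<^esub> (k \<odot>\<^bsub>A\<^esub> (a \<otimes>\<^bsub>A\<^esub> b)) \<in> F (i + j + 1))"

end

theory Submission
  imports Defs
begin

text \<open>
  In a brace \<open>u + x = u \<circ> (x + v * x)\<close>, where \<open>v\<close> is the \<open>\<circ>\<close>-inverse of \<open>u\<close>, so the brace identity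
  expresses \<open>(u + x) * c\<close> through terms in which the failure of additivity carries an additional
  factor and therefore lies one step deeper in the filtration: for \<open>x \<in> A\<^sub>m\<close> and \<open>c \<in> A\<^sub>k\<close>,
  \<open>(u + x) * c = u * c + x * c\<close> modulo \<open>A\<^sub>m\<^sub>+\<^sub>k\<^sub>+\<^sub>1\<close>. This makes the graded product well defined and
  biadditive. Applied to \<open>(a + b + a * b) * c\<close> it shows that the associator of \<open>a, b, c\<close> is, in top
  degree, \<open>a * c + b * c - (a + b) * c\<close>, which is symmetric in \<open>a\<close> and \<open>b\<close>.
\<close>

subsection \<open>Braces\<close>

text \<open>The degree \<open>n\<close> part of a product, computed on representatives. Degrees
  start at 1, so both \<open>i\<close> and \<open>n - i\<close> must be positive; for
  \<open>n \<le> 1\<close> the sum is empty.\<close>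

definition convolution :: "('a, 'm) ring_scheme \<Rightarrow> (nat \<Rightarrow> 'a) \<Rightarrow> (nat \<Rightarrow> 'a) \<Rightarrow> nat \<Rightarrow> 'a" where
  "convolution A f g n = (\<Oplus>\<^bsub>A\<^esub>i\<in>{1..<n}. f i \<otimes>\<^bsub>A\<^esub> g (n - i))"

context brace
begin

lemma star_zero_right: "a \<in> carrier A \<Longrightarrow> a \<otimes> \<zero> = \<zero>"
  using star_left_distrib[of a \<zero> \<zero>] by (simp add: star_closed)

lemma star_finsum_right:
  assumes "finite I" "a \<in> carrier A" "f \<in> I \<rightarrow> carrier A"
  shows "a \<otimes> finsum A f I = (\<Oplus>i\<in>I. a \<otimes> f i)"
  using assms
  by (induction I rule: finite_induct)
    (simp_all add: star_zero_right star_left_distrib star_closed Pi_iff)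

lemma zero_star: "c \<in> carrier A \<Longrightarrow> \<zero> \<otimes> c = \<zero>"
  using group.is_monoid[OF group_circ, THEN monoid.l_one, of c]
  by (simp add: circ_group_def circ_def star_closed)

lemma circ_star:
  assumes "a \<in> carrier A" "b \<in> carrier A" "c \<in> carrier A"
  shows "circ A a b \<otimes> c = a \<otimes> c \<oplus> b \<otimes> c \<oplus> a \<otimes> (b \<otimes> c)"
  using star_circ[OF assms] assms
    a_comm[of "a \<otimes> b" "a \<oplus> b"] a_assoc[of "a \<otimes> b" a b]
  unfolding circ_def by (simp add: star_closed)

text \<open>The right factor is what remains after composing \<open>u \<oplus> x\<close> from the
  left with the inverse \<open>v\<close> of \<open>u\<close> in \<open>circ_group A\<close>.\<close>

lemma add_eq_circ:
  assumes u: "u \<in> carrier A" and x: "x \<in> carrier A"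
  obtains v where "v \<in> carrier A" "u \<oplus> x = circ A u (x \<oplus> v \<otimes> x)"
proof -
  interpret C: group "circ_group A" by (rule group_circ)
  define v where "v = inv\<^bsub>circ_group A\<^esub> u"
  have car: "carrier (circ_group A) = carrier A" by (simp add: circ_group_def)
  have v: "v \<in> carrier A" using C.inv_closed[of u] u by (simp add: car v_def)
  have vu: "v \<oplus> u \<oplus> v \<otimes> u = \<zero>"
    using C.l_inv[of u] u by (simp add: car v_def[symmetric]) (simp add: circ_group_def circ_def)
  \<comment> \<open>Left distributivity collects the terms free of \<open>x\<close> into
    \<open>circ A v u\<close>, which is \<open>\<zero>\<close>.\<close>
  have "circ A v (u \<oplus> x) = (v \<oplus> u \<oplus> v \<otimes> u) \<oplus> (x \<oplus> v \<otimes> x)"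
    using u v x by (simp add: circ_def star_left_distrib star_closed a_ac)
  then have *: "circ A v (u \<oplus> x) = x \<oplus> v \<otimes> x"
    using vu u v x by (simp add: star_closed)
  have "u \<otimes>\<^bsub>circ_group A\<^esub> (v \<otimes>\<^bsub>circ_group A\<^esub> (u \<oplus> x)) = u \<oplus> x"
    using C.m_assoc[of u v "u \<oplus> x"] C.r_inv[of u] C.l_one[of "u \<oplus> x"] u x v
    by (simp add: car v_def[symmetric])
  then have "circ A u (circ A v (u \<oplus> x)) = u \<oplus> x" by (simp add: circ_group_def)
  with * v that show ?thesis by metis
qed

end

lemma (in abelian_monoid) finsum_Sigma:
  assumes "finite I" "\<And>i. i \<in> I \<Longrightarrow> finite (J i)"
    and "\<And>i j. i \<in> I \<Longrightarrow> j \<in> J i \<Longrightarrow> t i j \<in> carrier G"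
  shows "(\<Oplus>i\<in>I. \<Oplus>j\<in>J i. t i j) = finsum G (case_prod t) (Sigma I J)"
proof -
  have *: "(\<Oplus>j\<in>J i. t i j) = finsum G (case_prod t) (Pair i ` J i)" if "i \<in> I" for i
    using assms that by (subst finsum_reindex) (auto simp: inj_on_def)
  have "Sigma I J = (\<Union>i\<in>I. Pair i ` J i)" by auto
  then have "finsum G (case_prod t) (Sigma I J)
      = (\<Oplus>i\<in>I. finsum G (case_prod t) (Pair i ` J i))"
    using assms by (simp, subst add.finprod_UN_disjoint) (auto simp: pairwise_def disjnt_def)
  also have "\<dots> = (\<Oplus>i\<in>I. \<Oplus>j\<in>J i. t i j)"
    using assms by (intro finsum_cong') (auto simp: * intro!: finsum_closed)
  finally show ?thesis by simp
qed

subsection \<open>Congruences modulo the filtration\<close>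

text \<open>The scalar-free part of the setting. \<open>F_1\<close> gives every element of
  \<open>A\<close> degree 1, so by \<open>F_star\<close> multiplication by any element raises the
  degree by at least one.\<close>

locale filtered_brace = brace +
  fixes F :: "nat \<Rightarrow> 'a set"
  assumes F_subgroup: "1 \<le> i \<Longrightarrow> additive_subgroup (F i) A"
    and F_star_left: "\<lbrakk>1 \<le> i; a \<in> carrier A; x \<in> F i\<rbrakk> \<Longrightarrow> a \<otimes> x \<in> F i"
    and F_decreasing: "\<lbrakk>1 \<le> i; i \<le> j\<rbrakk> \<Longrightarrow> F j \<subseteq> F i"
    and F_star: "\<lbrakk>1 \<le> i; 1 \<le> j; a \<in> F i; b \<in> F j\<rbrakk> \<Longrightarrow> a \<otimes> b \<in> F (i + j)"
    and F_1: "F 1 = carrier A"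
begin

lemma F_abelian_subgroup: "1 \<le> i \<Longrightarrow> abelian_subgroup (F i) A"
  by (simp add: F_subgroup abelian_subgroupI3 abelian_group_axioms)

lemma F_carrier: "\<lbrakk>1 \<le> i; x \<in> F i\<rbrakk> \<Longrightarrow> x \<in> carrier A"
  using F_decreasing[of 1 i] F_1 by auto

lemma F_mono: "\<lbrakk>x \<in> F j; i \<le> j; 1 \<le> i\<rbrakk> \<Longrightarrow> x \<in> F i"
  using F_decreasing by blast

lemma F_zero: "1 \<le> i \<Longrightarrow> \<zero> \<in> F i"
  by (rule additive_subgroup.zero_closed[OF F_subgroup])

lemma F_add: "\<lbrakk>1 \<le> i; x \<in> F i; y \<in> F i\<rbrakk> \<Longrightarrow> x \<oplus> y \<in> F i"
  by (rule additive_subgroup.a_closed[OF F_subgroup])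

lemma F_uminus: "\<lbrakk>1 \<le> i; x \<in> F i\<rbrakk> \<Longrightarrow> \<ominus> x \<in> F i"
  by (rule additive_subgroup.a_inv_closed[OF F_subgroup])

lemma F_finsum:
  assumes "1 \<le> m" "finite I" "f \<in> I \<rightarrow> F m"
  shows "finsum A f I \<in> F m"
  using assms(2,3)
proof (induction I rule: finite_induct)
  case (insert i I)
  then have "f \<in> insert i I \<rightarrow> carrier A" using F_carrier assms(1) by blast
  with insert show ?case using assms(1) by (simp add: F_add Pi_iff)
qed (use assms(1) F_zero in simp)

lemma coset_eq_iff:
  assumes "1 \<le> m" "x \<in> carrier A" "y \<in> carrier A"
  shows "F m +> x = F m +> y \<longleftrightarrow> x \<ominus> y \<in> F m"
proof -
  interpret abelian_subgroup "F m" A using assms(1) by (rule F_abelian_subgroup)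
  show ?thesis
    unfolding minus_eq a_rcos_module[OF assms(3,2), symmetric]
    using a_repr_independence'[OF _ assms(3)] a_repr_independenceD[OF assms(2)] by metis
qed

lemma coset_zero_iff:
  assumes "1 \<le> m" "x \<in> carrier A"
  shows "F m +> x = F m \<longleftrightarrow> x \<in> F m"
proof -
  interpret abelian_subgroup "F m" A using assms(1) by (rule F_abelian_subgroup)
  show ?thesis
    using a_rcos_const a_rcos_self assms by blast
qed

lemma coset_add:
  assumes "1 \<le> m" "x \<in> carrier A" "y \<in> carrier A"
  shows "(F m +> x) <+> (F m +> y) = F m +> (x \<oplus> y)"
  using abelian_subgroup.a_rcos_sum[OF F_abelian_subgroup[OF assms(1)] assms(2,3)] .

lemma coset_add_cong:
  assumes "1 \<le> m" "x \<in> carrier A" "y \<in> carrier A" "x' \<in> carrier A" "y' \<in> carrier A"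
    and "F m +> x = F m +> x'" "F m +> y = F m +> y'"
  shows "F m +> (x \<oplus> y) = F m +> (x' \<oplus> y')"
  using assms by (metis coset_add)

lemma coset_absorb:
  assumes "1 \<le> m" "z \<in> carrier A" "w \<in> F m"
  shows "F m +> (z \<oplus> w) = F m +> z"
proof -
  have "w \<in> carrier A" using assms F_carrier by blast
  moreover from this have "F m +> w = F m +> \<zero>"
    using coset_zero_iff[OF assms(1)] F_zero[OF assms(1)] assms(3) by blast
  ultimately show ?thesis
    using coset_add_cong[of m z w z \<zero>] assms by simp
qed

lemma coset_finsum_cong:
  assumes "1 \<le> m" "finite I" "f \<in> I \<rightarrow> carrier A" "g \<in> I \<rightarrow> carrier A"
    and "\<And>i. i \<in> I \<Longrightarrow> F m +> f i = F m +> g i"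
  shows "F m +> finsum A f I = F m +> finsum A g I"
  using assms(2-5)
proof (induction I rule: finite_induct)
  case (insert i I)
  then have "f i \<in> carrier A" "g i \<in> carrier A" "f \<in> I \<rightarrow> carrier A" "g \<in> I \<rightarrow> carrier A"
    by auto
  with insert show ?case using assms(1) by (simp add: coset_add_cong)
qed simp

text \<open>Writing \<open>u \<oplus> x\<close> as \<open>circ A u y\<close> with
  \<open>y \<in> F m\<close>, the brace identity leaves besides \<open>u * c\<close> only
  \<open>y * c\<close> and \<open>u * (y * c)\<close>, both in \<open>F (m + k)\<close>.\<close>

lemma coset_star_add_mem:
  assumes "1 \<le> m" "1 \<le> k" "u \<in> carrier A" "x \<in> F m" "c \<in> F k"
  shows "F (m + k) +> (u \<oplus> x) \<otimes> c = F (m + k) +> u \<otimes> c"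
proof -
  have x: "x \<in> carrier A" and c: "c \<in> carrier A" using assms F_carrier by blast+
  obtain v where v: "v \<in> carrier A" and eq: "u \<oplus> x = circ A u (x \<oplus> v \<otimes> x)"
    using add_eq_circ[OF assms(3) x] .
  define y where "y = x \<oplus> v \<otimes> x"
  \<comment> \<open>\<open>F m\<close> absorbs multiplication from the left, so the correction
    \<open>v \<otimes> x\<close> does not leave it.\<close>
  have yF: "y \<in> F m" using assms v by (simp add: y_def F_add F_star_left)
  then have y: "y \<in> carrier A" using F_carrier assms by blast
  have "(u \<oplus> x) \<otimes> c = u \<otimes> c \<oplus> (y \<otimes> c \<oplus> u \<otimes> (y \<otimes> c))"
    using eq circ_star[OF assms(3) y c] assms(3) y c by (simp add: y_def[symmetric] star_closed a_assoc)
  moreover have "y \<otimes> c \<oplus> u \<otimes> (y \<otimes> c) \<in> F (m + k)"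
    using assms yF by (simp add: F_add F_star_left F_star)
  moreover have "F (m + k) +> (u \<otimes> c \<oplus> z) = F (m + k) +> u \<otimes> c" if "z \<in> F (m + k)" for z
    using that assms c by (simp add: star_closed coset_absorb)
  ultimately show ?thesis by simp
qed

text \<open>One degree finer than \<open>coset_star_add_mem\<close>: the term of exact degree
  \<open>m + k\<close> has to be kept and identified as \<open>x * c\<close>.\<close>

lemma coset_star_add:
  assumes "1 \<le> m" "1 \<le> k" "u \<in> carrier A" "x \<in> F m" "c \<in> F k"
  shows "F (m + k + 1) +> (u \<oplus> x) \<otimes> c = F (m + k + 1) +> (u \<otimes> c \<oplus> x \<otimes> c)"
proof -
  let ?G = "F (m + k + 1)"
  have x: "x \<in> carrier A" and c: "c \<in> carrier A" using assms F_carrier by blast+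
  obtain v where v: "v \<in> carrier A" and eq: "u \<oplus> x = circ A u (x \<oplus> v \<otimes> x)"
    using add_eq_circ[OF assms(3) x] .
  \<comment> \<open>Here \<open>v\<close>, and below \<open>u\<close>, is used as an element of
    \<open>F 1\<close>; this is the source of the additional degree.\<close>
  have vx: "v \<otimes> x \<in> F (m + 1)" using F_star[of 1 m v x] v assms F_1 by simp
  define y where "y = x \<oplus> v \<otimes> x"
  have "y \<in> F m" using assms v by (simp add: y_def F_add F_star_left)
  then have y: "y \<in> carrier A" and yc: "y \<otimes> c \<in> F (m + k)"
    using F_carrier F_star assms by blast+
  have "(u \<oplus> x) \<otimes> c = u \<otimes> c \<oplus> y \<otimes> c \<oplus> u \<otimes> (y \<otimes> c)"
    using eq circ_star[OF assms(3) y c] by (simp add: y_def[symmetric])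
  moreover have "u \<otimes> (y \<otimes> c) \<in> ?G"
    using F_star[of 1 "m + k" u "y \<otimes> c"] yc assms F_1 by simp
  ultimately have "?G +> (u \<oplus> x) \<otimes> c = ?G +> (u \<otimes> c \<oplus> y \<otimes> c)"
    using assms c y by (simp add: coset_absorb star_closed)
  \<comment> \<open>\<open>y\<close> and \<open>x\<close> differ by \<open>v \<otimes> x\<close>, so
    the coarser lemma in degree \<open>m + 1\<close> already yields the finer modulus.\<close>
  moreover have "?G +> y \<otimes> c = ?G +> x \<otimes> c"
    using coset_star_add_mem[OF _ assms(2) x vx assms(5)] by (simp add: y_def)
  ultimately show ?thesis
    using assms c x y by (simp add: star_closed coset_add_cong)
qed

text \<open>Independence of representatives for the graded product. A change of the left factor by
  \<open>F (i + 1)\<close> is absorbed by \<open>coset_star_add_mem\<close>, a change of the right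
  factor by exact left distributivity.\<close>

lemma coset_star_cong:
  assumes "1 \<le> i" "1 \<le> j" "a \<in> F i" "b \<in> F j" "a' \<in> F i" "b' \<in> F j"
    and "F (i + 1) +> a' = F (i + 1) +> a" "F (j + 1) +> b' = F (j + 1) +> b"
  shows "F (i + j + 1) +> a' \<otimes> b' = F (i + j + 1) +> a \<otimes> b"
proof -
  have car: "a \<in> carrier A" "b \<in> carrier A" "a' \<in> carrier A" "b' \<in> carrier A"
    using assms F_carrier by blast+
  have da: "a' \<ominus> a \<in> F (i + 1)" and db: "b' \<ominus> b \<in> F (j + 1)"
    using assms car coset_eq_iff by simp_all
  have ea: "a' = a \<oplus> (a' \<ominus> a)" and eb: "b' = b \<oplus> (b' \<ominus> b)"
    using car a_lcomm[of a a' "\<ominus> a"] a_lcomm[of b b' "\<ominus> b"] by (simp_all add: minus_eq r_neg)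
  have "F (i + j + 1) +> a' \<otimes> b' = F (i + j + 1) +> a \<otimes> b'"
    using coset_star_add_mem[of "i + 1" j a "a' \<ominus> a" b'] assms car da ea by simp
  also have "a \<otimes> b' = a \<otimes> b \<oplus> a \<otimes> (b' \<ominus> b)"
    using star_left_distrib[of a b "b' \<ominus> b"] eb car by simp
  also have "F (i + j + 1) +> \<dots> = F (i + j + 1) +> a \<otimes> b"
    using coset_absorb[of "i + j + 1" "a \<otimes> b" "a \<otimes> (b' \<ominus> b)"] F_star[of i "j + 1" a "b' \<ominus> b"]
      assms car db by (simp add: star_closed)
  finally show ?thesis .
qed

lemma coset_finsum_star:
  assumes "1 \<le> m" "1 \<le> k" "finite I" "f \<in> I \<rightarrow> F m" "c \<in> F k"
  shows "F (m + k + 1) +> finsum A f I \<otimes> c = F (m + k + 1) +> (\<Oplus>i\<in>I. f i \<otimes> c)"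
  using assms(3,4)
proof (induction I rule: finite_induct)
  case empty
  then show ?case using assms F_carrier by (simp add: zero_star)
next
  case (insert i I)
  have c: "c \<in> carrier A" using assms F_carrier by blast
  have fF: "f i \<in> F m" "f \<in> I \<rightarrow> F m" using insert by auto
  then have f: "f i \<in> carrier A" "f \<in> I \<rightarrow> carrier A" using assms(1) F_carrier by blast+
  have fc: "(\<lambda>i. f i \<otimes> c) \<in> I \<rightarrow> carrier A" using f c star_closed by auto
  \<comment> \<open>The partial sum is the summand required to have degree \<open>m\<close>, which
    \<open>F_finsum\<close> provides.\<close>
  have "F (m + k + 1) +> (f i \<oplus> finsum A f I) \<otimes> c
      = F (m + k + 1) +> (f i \<otimes> c \<oplus> finsum A f I \<otimes> c)"
    using coset_star_add[OF assms(1,2) f(1) F_finsum[OF assms(1) insert(1) fF(2)] assms(5)] .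
  also have "\<dots> = F (m + k + 1) +> (f i \<otimes> c \<oplus> (\<Oplus>i\<in>I. f i \<otimes> c))"
    using insert.IH[OF fF(2)] f c fc by (intro coset_add_cong) (auto intro: star_closed)
  finally show ?case using insert(1,2) f c fc by (simp add: star_closed)
qed

text \<open>The symmetry of the associator, with terms moved across so that no subtraction occurs.\<close>
lemma coset_associator:
  assumes "1 \<le> i" "1 \<le> j" "1 \<le> k" "a \<in> F i" "b \<in> F j" "c \<in> F k"
  shows "F (i + j + k + 1) +> ((a \<otimes> b) \<otimes> c \<oplus> b \<otimes> (a \<otimes> c))
    = F (i + j + k + 1) +> ((b \<otimes> a) \<otimes> c \<oplus> a \<otimes> (b \<otimes> c))"
proof -
  let ?G = "F (i + j + k + 1)"
  have pos: "1 \<le> i + j + k + 1" by simp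
  have car: "a \<in> carrier A" "b \<in> carrier A" "c \<in> carrier A"
    using assms F_carrier by blast+
  note cl = star_closed[OF car(1,2)] star_closed[OF car(2,1)] star_closed[OF car(1,3)]
    star_closed[OF car(2,3)]
  note cl2 = cl star_closed[OF cl(1) car(3)] star_closed[OF cl(2) car(3)]
    star_closed[OF car(1) cl(4)] star_closed[OF car(2) cl(3)]
    star_closed[OF a_closed[OF car(1,2)] car(3)]
  \<comment> \<open>\<open>circ A a b\<close> is expanded twice: exactly by the brace identity, and
    modulo \<open>?G\<close> as the sum of \<open>a \<oplus> b\<close> and
    \<open>a \<otimes> b\<close>, the latter of degree \<open>i + j\<close>.\<close>
  have 1: "?G +> (a \<otimes> c \<oplus> b \<otimes> c \<oplus> a \<otimes> (b \<otimes> c)) = ?G +> ((a \<oplus> b) \<otimes> c \<oplus> (a \<otimes> b) \<otimes> c)"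
    using coset_star_add[of "i + j" k "a \<oplus> b" "a \<otimes> b" c] circ_star[OF car] F_star assms car
    by (simp add: circ_def)
  have 2: "?G +> (a \<otimes> c \<oplus> b \<otimes> c \<oplus> b \<otimes> (a \<otimes> c)) = ?G +> ((a \<oplus> b) \<otimes> c \<oplus> (b \<otimes> a) \<otimes> c)"
    using coset_star_add[of "i + j" k "b \<oplus> a" "b \<otimes> a" c] circ_star[OF car(2,1,3)]
      F_star[of j i b a] assms car cl
    by (simp add: circ_def a_comm add.commute)
  \<comment> \<open>\<open>p\<close> and \<open>q\<close> are the parts unchanged by exchanging
    \<open>a\<close> and \<open>b\<close>. Adding the first congruence, read backwards, to the
    second puts \<open>p \<oplus> q\<close> on both sides, where it cancels.\<close>
  define p where "p = (a \<oplus> b) \<otimes> c"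
  define q where "q = a \<otimes> c \<oplus> b \<otimes> c"
  have pq: "p \<in> carrier A" "q \<in> carrier A" using cl2 by (simp_all add: p_def q_def)
  have "?G +> ((p \<oplus> (a \<otimes> b) \<otimes> c) \<oplus> (q \<oplus> b \<otimes> (a \<otimes> c)))
      = ?G +> ((q \<oplus> a \<otimes> (b \<otimes> c)) \<oplus> (p \<oplus> (b \<otimes> a) \<otimes> c))"
    by (rule coset_add_cong[OF pos])
      (use 1[folded p_def q_def] 2[folded p_def q_def] pq cl2 in simp_all)
  note sum_eq = this
  have "?G +> ((\<ominus> (p \<oplus> q)) \<oplus> ((p \<oplus> (a \<otimes> b) \<otimes> c) \<oplus> (q \<oplus> b \<otimes> (a \<otimes> c))))
      = ?G +> ((\<ominus> (p \<oplus> q)) \<oplus> ((q \<oplus> a \<otimes> (b \<otimes> c)) \<oplus> (p \<oplus> (b \<otimes> a) \<otimes> c)))"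
    by (rule coset_add_cong[OF pos _ _ _ _ refl sum_eq]) (use pq cl2 in simp_all)
  moreover have "\<ominus> (p \<oplus> q) \<oplus> ((p \<oplus> r) \<oplus> (q \<oplus> s)) = r \<oplus> s"
    "\<ominus> (p \<oplus> q) \<oplus> ((q \<oplus> r) \<oplus> (p \<oplus> s)) = s \<oplus> r"
    if "r \<in> carrier A" "s \<in> carrier A" for r s
  proof -
    have "(p \<oplus> r) \<oplus> (q \<oplus> s) = (p \<oplus> q) \<oplus> (r \<oplus> s)"
      "(q \<oplus> r) \<oplus> (p \<oplus> s) = (p \<oplus> q) \<oplus> (s \<oplus> r)"
      using pq that by (simp_all add: a_ac)
    then show "\<ominus> (p \<oplus> q) \<oplus> ((p \<oplus> r) \<oplus> (q \<oplus> s)) = r \<oplus> s"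
      "\<ominus> (p \<oplus> q) \<oplus> ((q \<oplus> r) \<oplus> (p \<oplus> s)) = s \<oplus> r"
      using pq that by (simp_all add: r_neg1)
  qed
  ultimately show ?thesis using cl2 by simp
qed

subsection \<open>Convolution of representatives\<close>

text \<open>Representatives of an element of the direct sum. Finite support is a condition on
  classes: almost all entries lie in \<open>F (n + 1)\<close> and need not vanish. This admits every
  choice of representatives.\<close>

definition graded_family :: "(nat \<Rightarrow> 'a) \<Rightarrow> bool" where
  "graded_family f \<longleftrightarrow> (\<forall>n\<ge>1. f n \<in> F n) \<and> (\<exists>N. \<forall>n\<ge>N. f n \<in> F (n + 1))"

lemma graded_family_mem: "\<lbrakk>graded_family f; 1 \<le> n\<rbrakk> \<Longrightarrow> f n \<in> F n"
  by (simp add: graded_family_def)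

lemma graded_family_carrier: "\<lbrakk>graded_family f; 1 \<le> n\<rbrakk> \<Longrightarrow> f n \<in> carrier A"
  using graded_family_mem F_carrier by blast

lemma graded_family_zero: "graded_family (\<lambda>n. \<zero>)"
  by (simp add: graded_family_def F_zero)

lemma graded_family_add:
  assumes "graded_family f" "graded_family g"
  shows "graded_family (\<lambda>n. f n \<oplus> g n)"
proof -
  obtain M N where "\<forall>n\<ge>M. f n \<in> F (n + 1)" "\<forall>n\<ge>N. g n \<in> F (n + 1)"
    using assms by (auto simp: graded_family_def)
  then have "\<forall>n\<ge>max M N. f n \<oplus> g n \<in> F (n + 1)" by (simp add: F_add)
  then have "\<exists>N. \<forall>n\<ge>N. f n \<oplus> g n \<in> F (n + 1)" by blast
  then show ?thesis using assms unfolding graded_family_def by (simp add: F_add)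
qed

lemma graded_family_uminus: "graded_family f \<Longrightarrow> graded_family (\<lambda>n. \<ominus> f n)"
  unfolding graded_family_def by (meson F_uminus le_add2)

lemma graded_family_single:
  assumes "1 \<le> i" "a \<in> F i"
  shows "graded_family (\<lambda>n. if n = i then a else \<zero>)"
proof -
  have "\<forall>n\<ge>i + 1. (if n = i then a else \<zero>) \<in> F (n + 1)" using F_zero by simp
  then have "\<exists>N. \<forall>n\<ge>N. (if n = i then a else \<zero>) \<in> F (n + 1)" by blast
  then show ?thesis using assms F_zero unfolding graded_family_def by simp
qed

lemma convolution_summand:
  assumes "graded_family f" "graded_family g" "i \<in> {1..<n}"
  shows "f i \<otimes> g (n - i) \<in> F n"
proof -
  have "1 \<le> i" "1 \<le> n - i" "i + (n - i) = n" using assms(3) by auto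
  then show ?thesis
    using F_star[of i "n - i" "f i" "g (n - i)"] assms(1,2) graded_family_mem by metis
qed

lemma convolution_closed:
  assumes "graded_family f" "graded_family g" "i \<in> {1..<n}"
  shows "f i \<otimes> g (n - i) \<in> carrier A"
  using convolution_summand[OF assms] F_carrier[of n] assms(3) by simp

lemma graded_family_convolution:
  assumes f: "graded_family f" and g: "graded_family g"
  shows "graded_family (convolution A f g)"
proof -
  obtain M N where M: "\<forall>n\<ge>M. f n \<in> F (n + 1)" and N: "\<forall>n\<ge>N. g n \<in> F (n + 1)"
    using assms by (auto simp: graded_family_def)
  have "convolution A f g n \<in> F (n + 1)" if n: "M + N \<le> n" for n
    unfolding convolution_def
  proof (rule F_finsum; (rule Pi_I)?)
    fix i assume i: "i \<in> {1..<n}"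
    then have pos: "1 \<le> i" "1 \<le> n - i" and le: "i \<le> n" by auto
    \<comment> \<open>As \<open>i\<close> and \<open>n - i\<close> add up to \<open>n\<close>, at
      least one factor has passed its threshold and lies one step deeper than its degree, and so
      does the product.\<close>
    consider "M \<le> i" | "N \<le> n - i" using n by linarith
    then show "f i \<otimes> g (n - i) \<in> F (n + 1)"
    proof cases
      case 1
      then show ?thesis
        using F_star[of "i + 1" "n - i" "f i" "g (n - i)"] pos le M graded_family_mem[OF g] by simp
    next
      case 2
      then show ?thesis
        using F_star[of i "n - i + 1" "f i" "g (n - i)"] pos le N graded_family_mem[OF f] by simp
    qed
  qed simp_all
  moreover have "convolution A f g n \<in> F n" if "1 \<le> n" for n
    unfolding convolution_def using that convolution_summand[OF assms] by (intro F_finsum) auto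
  ultimately show ?thesis unfolding graded_family_def by blast
qed

lemma convolution_add_right:
  assumes f: "graded_family f" and g: "graded_family g" and h: "graded_family h"
  shows "convolution A f (\<lambda>n. g n \<oplus> h n) n = convolution A f g n \<oplus> convolution A f h n"
proof -
  have "convolution A f (\<lambda>n. g n \<oplus> h n) n
      = (\<Oplus>i\<in>{1..<n}. f i \<otimes> g (n - i) \<oplus> f i \<otimes> h (n - i))"
    unfolding convolution_def
    using convolution_closed[OF f g] convolution_closed[OF f h]
      graded_family_carrier[OF f] graded_family_carrier[OF g] graded_family_carrier[OF h]
    by (intro finsum_cong') (auto simp: star_left_distrib)
  also have "\<dots> = convolution A f g n \<oplus> convolution A f h n"
    unfolding convolution_def
    using convolution_closed[OF f g] convolution_closed[OF f h] by (intro finsum_addf) auto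
  finally show ?thesis .
qed

text \<open>In contrast to \<open>convolution_add_right\<close> this is only a congruence: each
  summand splits by \<open>coset_star_add\<close>, up to an error one degree deeper.\<close>

lemma coset_convolution_add_left:
  assumes f: "graded_family f" and g: "graded_family g" and h: "graded_family h"
  shows "F (n + 1) +> convolution A (\<lambda>n. f n \<oplus> g n) h n
    = F (n + 1) +> (convolution A f h n \<oplus> convolution A g h n)"
proof -
  note fg = graded_family_add[OF f g]
  have "F (n + 1) +> (f i \<oplus> g i) \<otimes> h (n - i)
      = F (n + 1) +> (f i \<otimes> h (n - i) \<oplus> g i \<otimes> h (n - i))" if "i \<in> {1..<n}" for i
  proof -
    have pos: "1 \<le> i" "1 \<le> n - i" and "i + (n - i) = n" using that by auto
    then show ?thesis
      using coset_star_add[OF pos graded_family_carrier[OF f pos(1)]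
          graded_family_mem[OF g pos(1)] graded_family_mem[OF h pos(2)]] by simp
  qed
  then have "F (n + 1) +> convolution A (\<lambda>n. f n \<oplus> g n) h n
      = F (n + 1) +> (\<Oplus>i\<in>{1..<n}. f i \<otimes> h (n - i) \<oplus> g i \<otimes> h (n - i))"
    unfolding convolution_def
    using convolution_closed[OF f h] convolution_closed[OF g h] convolution_closed[OF fg h]
    by (intro coset_finsum_cong) auto
  also have "(\<Oplus>i\<in>{1..<n}. f i \<otimes> h (n - i) \<oplus> g i \<otimes> h (n - i))
      = convolution A f h n \<oplus> convolution A g h n"
    unfolding convolution_def
    using convolution_closed[OF f h] convolution_closed[OF g h] by (intro finsum_addf) auto
  finally show ?thesis .
qed

section \<open>Products of three families\<close>

text \<open>The degrees of the first two factors in a triple product of total degree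
  \<open>n\<close>; the third degree \<open>n - i - j\<close> is then at least 1. Both bracketings
  are brought to this index set so that they can be compared term by term.\<close>

definition inner_indices :: "nat \<Rightarrow> (nat \<times> nat) set" where
  "inner_indices n = (SIGMA i:{1..<n}. {1..<n - i})"

lemma inner_indices_iff: "(i, j) \<in> inner_indices n \<longleftrightarrow> 1 \<le> i \<and> 1 \<le> j \<and> i + j < n"
  by (auto simp: inner_indices_def)

lemma finite_inner_indices: "finite (inner_indices n)"
  by (simp add: inner_indices_def)

lemma triple_closed:
  assumes "graded_family f" "graded_family g" "graded_family h" "(i, j) \<in> inner_indices n"
  shows "(f i \<otimes> g j) \<otimes> h (n - i - j) \<in> carrier A" "f i \<otimes> (g j \<otimes> h (n - i - j)) \<in> carrier A"
proof -
  have "1 \<le> i" "1 \<le> j" "1 \<le> n - i - j" using assms(4) by (auto simp: inner_indices_iff)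
  then show "(f i \<otimes> g j) \<otimes> h (n - i - j) \<in> carrier A" "f i \<otimes> (g j \<otimes> h (n - i - j)) \<in> carrier A"
    using assms(1-3) by (simp_all add: star_closed graded_family_carrier)
qed

text \<open>The index set is symmetric. Exchanging the first two factors of a triple product also
  exchanges their degrees, and this realigns the indices.\<close>

lemma finsum_inner_indices_swap:
  assumes "\<And>i j. (i, j) \<in> inner_indices n \<Longrightarrow> t i j \<in> carrier A"
  shows "finsum A (case_prod t) (inner_indices n) = finsum A (\<lambda>(i, j). t j i) (inner_indices n)"
proof -
  have "inner_indices n = prod.swap ` inner_indices n"
    by (force simp: inner_indices_iff image_iff prod.swap_def Bex_def)
  then have "finsum A (case_prod t) (inner_indices n)
      = finsum A (case_prod t) (prod.swap ` inner_indices n)" by simp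
  also have "\<dots> = finsum A (\<lambda>p. case_prod t (prod.swap p)) (inner_indices n)"
    using assms by (intro finsum_reindex) (auto simp: inner_indices_iff)
  finally show ?thesis by (simp add: case_prod_unfold)
qed

lemma coset_convolution_assoc_left:
  assumes f: "graded_family f" and g: "graded_family g" and h: "graded_family h"
  shows "F (n + 1) +> convolution A (convolution A f g) h n
    = F (n + 1) +> finsum A (\<lambda>(i, j). (f i \<otimes> g j) \<otimes> h (n - i - j)) (inner_indices n)"
proof -
  \<comment> \<open>\<open>p\<close> is the degree of the inner product, so the indices are the sum
    of the first two degrees and the first degree.\<close>
  let ?t = "\<lambda>p i. (f i \<otimes> g (p - i)) \<otimes> h (n - p)"
  have t: "?t p i \<in> carrier A" if "p \<in> {1..<n}" "i \<in> {1..<p}" for p i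
    using that convolution_closed[OF f g, of i p] graded_family_carrier[OF h, of "n - p"]
    by (intro star_closed[OF _ graded_family_carrier[OF h]]) auto
  \<comment> \<open>The inner sum is a left factor, so it can be multiplied out only modulo
    \<open>F (n + 1)\<close>; all its terms have degree \<open>p\<close>, as
    \<open>coset_finsum_star\<close> demands.\<close>
  have "F (n + 1) +> convolution A f g p \<otimes> h (n - p) = F (n + 1) +> (\<Oplus>i\<in>{1..<p}. ?t p i)"
    if p: "p \<in> {1..<n}" for p
  proof -
    have pos: "1 \<le> p" "1 \<le> n - p" and "p + (n - p) = n" using p by auto
    moreover have "(\<lambda>i. f i \<otimes> g (p - i)) \<in> {1..<p} \<rightarrow> F p"
      using convolution_summand[OF f g] by blast
    ultimately show ?thesis
      using coset_finsum_star[OF pos finite_atLeastLessThan _ graded_family_mem[OF h pos(2)],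
          of "\<lambda>i. f i \<otimes> g (p - i)" 1 p]
      unfolding convolution_def by simp
  qed
  then have "F (n + 1) +> convolution A (convolution A f g) h n
      = F (n + 1) +> (\<Oplus>p\<in>{1..<n}. \<Oplus>i\<in>{1..<p}. ?t p i)"
    unfolding convolution_def[of A "convolution A f g"]
    using convolution_closed[OF graded_family_convolution[OF f g] h] t
    by (intro coset_finsum_cong) (auto intro!: finsum_closed)
  also have "(\<Oplus>p\<in>{1..<n}. \<Oplus>i\<in>{1..<p}. ?t p i)
      = finsum A (case_prod ?t) (SIGMA p:{1..<n}. {1..<p})"
    using t by (intro finsum_Sigma) auto
  also have "(SIGMA p:{1..<n}. {1..<p}) = (\<lambda>(i, j). (i + j, i)) ` inner_indices n"
  proof (intro equalityI subsetI)
    fix q assume "q \<in> (SIGMA p:{1..<n}. {1..<p})"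
    then show "q \<in> (\<lambda>(i, j). (i + j, i)) ` inner_indices n"
      by (intro image_eqI[of _ _ "(snd q, fst q - snd q)"]) (auto simp: inner_indices_iff)
  qed (auto simp: inner_indices_iff)
  also have "finsum A (case_prod ?t) \<dots>
      = finsum A (\<lambda>(i, j). (f i \<otimes> g j) \<otimes> h (n - i - j)) (inner_indices n)"
    using triple_closed[OF f g h]
    by (subst finsum_reindex) (auto simp: inj_on_def case_prod_unfold intro!: finsum_cong')
  finally show ?thesis .
qed

text \<open>The inner sum is now a right factor, so left distributivity gives an equality, already
  indexed in the shape of \<open>inner_indices\<close>.\<close>

lemma convolution_assoc_right:
  assumes f: "graded_family f" and g: "graded_family g" and h: "graded_family h"
  shows "convolution A f (convolution A g h) n
    = finsum A (\<lambda>(i, j). f i \<otimes> (g j \<otimes> h (n - i - j))) (inner_indices n)"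
proof -
  have "convolution A f (convolution A g h) n
      = (\<Oplus>i\<in>{1..<n}. \<Oplus>j\<in>{1..<n - i}. f i \<otimes> (g j \<otimes> h (n - i - j)))"
    unfolding convolution_def
  proof (intro finsum_cong')
    fix i assume i: "i \<in> {1..<n}"
    have gh: "(\<lambda>j. g j \<otimes> h (n - i - j)) \<in> {1..<n - i} \<rightarrow> carrier A"
      using convolution_closed[OF g h] by blast
    show "f i \<otimes> (\<Oplus>j\<in>{1..<n - i}. g j \<otimes> h (n - i - j))
        = (\<Oplus>j\<in>{1..<n - i}. f i \<otimes> (g j \<otimes> h (n - i - j)))"
      using star_finsum_right[OF _ _ gh] graded_family_carrier[OF f] i by simp
  next
    show "(\<lambda>i. \<Oplus>j\<in>{1..<n - i}. f i \<otimes> (g j \<otimes> h (n - i - j))) \<in> {1..<n} \<rightarrow> carrier A"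
      using triple_closed(2)[OF f g h] by (auto simp: inner_indices_iff intro!: finsum_closed)
  qed simp
  also have "\<dots> = finsum A (\<lambda>(i, j). f i \<otimes> (g j \<otimes> h (n - i - j))) (inner_indices n)"
    unfolding inner_indices_def
    using triple_closed(2)[OF f g h] by (intro finsum_Sigma) (auto simp: inner_indices_iff)
  finally show ?thesis .
qed

text \<open>Both sides become single sums over \<open>inner_indices n\<close>, whose terms agree
  modulo \<open>F (n + 1)\<close> by \<open>coset_associator\<close>.\<close>

lemma coset_convolution_associator:
  assumes f: "graded_family f" and g: "graded_family g" and h: "graded_family h"
  shows "F (n + 1) +> (convolution A (convolution A f g) h n \<oplus> convolution A g (convolution A f h) n)
    = F (n + 1) +> (convolution A (convolution A g f) h n \<oplus> convolution A f (convolution A g h) n)"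
proof (cases "n = 0")
  case True
  then show ?thesis by (simp add: convolution_def)
next
  case False
  let ?G = "F (n + 1)"
  \<comment> \<open>Stated for arbitrary families because it is used a second time with
    \<open>f\<close> and \<open>g\<close> exchanged.\<close>
  have split: "?G +> (convolution A (convolution A f g) h n \<oplus> convolution A g (convolution A f h) n)
      = ?G +> finsum A (\<lambda>(i, j). (f i \<otimes> g j) \<otimes> h (n - i - j) \<oplus> g j \<otimes> (f i \<otimes> h (n - i - j)))
        (inner_indices n)"
    if f: "graded_family f" and g: "graded_family g" for f g
  proof -
    let ?s = "\<lambda>(i, j). (f i \<otimes> g j) \<otimes> h (n - i - j)"
    let ?t = "\<lambda>(i, j). g j \<otimes> (f i \<otimes> h (n - i - j))"
    have s: "?s \<in> inner_indices n \<rightarrow> carrier A"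
      using triple_closed(1)[OF f g h] by auto
    have sw: "(j, i) \<in> inner_indices n" if "(i, j) \<in> inner_indices n" for i j
      using that by (auto simp: inner_indices_iff)
    have t: "?t \<in> inner_indices n \<rightarrow> carrier A"
      using triple_closed(2)[OF g f h sw] by (auto simp: add.commute)
    \<comment> \<open>\<open>convolution_assoc_right\<close> lists the degree of \<open>g\<close>
      first; the swap puts the degree of \<open>f\<close> first, as in the other sum.\<close>
    have "convolution A g (convolution A f h) n = finsum A ?t (inner_indices n)"
      using convolution_assoc_right[OF g f h, of n] triple_closed(2)[OF g f h]
        finsum_inner_indices_swap[of n "\<lambda>j i. g j \<otimes> (f i \<otimes> h (n - j - i))"]
      by (simp add: add.commute)
    moreover have "convolution A (convolution A f g) h n \<in> carrier A"
      "convolution A g (convolution A f h) n \<in> carrier A"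
      using False f g h by (auto intro!: graded_family_carrier graded_family_convolution)
    ultimately have "?G +> (convolution A (convolution A f g) h n \<oplus> convolution A g (convolution A f h) n)
      = ?G +> (finsum A ?s (inner_indices n) \<oplus> finsum A ?t (inner_indices n))"
      using coset_convolution_assoc_left[OF f g h, of n] s t
      by (intro coset_add_cong) (auto intro!: finsum_closed)
    also have "finsum A ?s (inner_indices n) \<oplus> finsum A ?t (inner_indices n)
      = finsum A (\<lambda>p. ?s p \<oplus> ?t p) (inner_indices n)"
      using finsum_addf[OF s t] by simp
    finally show ?thesis by (simp add: case_prod_unfold)
  qed
  let ?l = "\<lambda>i j. (f i \<otimes> g j) \<otimes> h (n - i - j) \<oplus> g j \<otimes> (f i \<otimes> h (n - i - j))"
  let ?r = "\<lambda>i j. (g j \<otimes> f i) \<otimes> h (n - i - j) \<oplus> f i \<otimes> (g j \<otimes> h (n - i - j))"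
  have mem: "f i \<in> F i" "g j \<in> F j" "h (n - i - j) \<in> F (n - i - j)"
    "f i \<in> carrier A" "g j \<in> carrier A" "h (n - i - j) \<in> carrier A"
    if "(i, j) \<in> inner_indices n" for i j
  proof -
    have "1 \<le> i" "1 \<le> j" "1 \<le> n - i - j" using that by (auto simp: inner_indices_iff)
    then show "f i \<in> F i" "g j \<in> F j" "h (n - i - j) \<in> F (n - i - j)"
      "f i \<in> carrier A" "g j \<in> carrier A" "h (n - i - j) \<in> carrier A"
      using f g h graded_family_mem graded_family_carrier by blast+
  qed
  have cl: "?l i j \<in> carrier A" "?r i j \<in> carrier A" if "(i, j) \<in> inner_indices n" for i j
    using mem[OF that] by (simp_all add: star_closed)
  have "?G +> ?l i j = ?G +> ?r i j" if "(i, j) \<in> inner_indices n" for i j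
    using coset_associator[of i j "n - i - j" "f i" "g j" "h (n - i - j)"] that mem[OF that]
    by (auto simp: inner_indices_iff)
  then have "?G +> finsum A (case_prod ?l) (inner_indices n)
      = ?G +> finsum A (case_prod ?r) (inner_indices n)"
    using cl finite_inner_indices by (intro coset_finsum_cong) auto
  \<comment> \<open>The exchanged instance of \<open>split\<close> lists the degree of
    \<open>g\<close> first, hence one more swap.\<close>
  also have "finsum A (case_prod ?r) (inner_indices n) = finsum A (\<lambda>(j, i). ?r i j) (inner_indices n)"
    using cl by (intro finsum_inner_indices_swap) auto
  finally show ?thesis
    using split[OF f g] split[OF g f] by (simp add: diff_commute[of n] add.commute case_prod_unfold)
qed

end

subsection \<open>The associated graded structure\<close>

text \<open>Passes from the subtraction-free form of associator symmetry to the differences in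
  \<open>associator\<close>.\<close>

lemma (in abelian_group) minus_eq_minusI:
  assumes "x \<oplus> y' = x' \<oplus> y" "x \<in> carrier G" "y \<in> carrier G" "x' \<in> carrier G" "y' \<in> carrier G"
  shows "x \<ominus> y = x' \<ominus> y'"
proof -
  have "x \<ominus> y = x \<oplus> (y' \<oplus> \<ominus> y') \<oplus> \<ominus> y" using assms(2-) by (simp add: minus_eq r_neg)
  also have "\<dots> = (x \<oplus> y') \<oplus> (\<ominus> y \<oplus> \<ominus> y')" using assms(2-) by (simp add: a_ac)
  also have "\<dots> = x' \<oplus> (y \<oplus> \<ominus> y) \<oplus> \<ominus> y'"
    unfolding assms(1) using assms(2-) by (simp add: a_ac)
  also have "\<dots> = x' \<ominus> y'" using assms(2-) by (simp add: minus_eq r_neg)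
  finally show ?thesis .
qed

locale filtered_K_brace = K_brace K A for K (structure) and A (structure) +
  fixes F :: "nat \<Rightarrow> 'c set"
  assumes filtration: "descending_ideal_filtration K A F"
begin

lemma F_submodule: "1 \<le> i \<Longrightarrow> submodule (F i) K A"
  using filtration by (simp add: descending_ideal_filtration_def K_brace_ideal_def)

lemma F_antimono:
  assumes "1 \<le> i" "i \<le> j"
  shows "F j \<subseteq> F i"
  using assms(2)
proof (induction j rule: dec_induct)
  case (step n)
  have "\<forall>i\<ge>1. F (i + 1) \<subseteq> F i"
    using filtration unfolding descending_ideal_filtration_def by (elim conjE)
  moreover have "1 \<le> n" using step.hyps(1) assms(1) by simp
  ultimately have "F (Suc n) \<subseteq> F n" by (metis Suc_eq_plus1)
  then show ?case using step.IH by (rule order_trans)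
qed simp

sublocale filtered_brace A F
proof (intro filtered_brace.intro filtered_brace_axioms.intro brace_axioms)
  fix i j :: nat and a b x
  show "additive_subgroup (F i) A" if "1 \<le> i"
    using F_submodule[OF that] by (simp add: additive_subgroup_def submodule_def)
  show "a \<otimes>\<^bsub>A\<^esub> x \<in> F i" if "1 \<le> i" "a \<in> carrier A" "x \<in> F i"
    using filtration that by (simp add: descending_ideal_filtration_def K_brace_ideal_def)
  show "F j \<subseteq> F i" if "1 \<le> i" "i \<le> j" using F_antimono that .
  show "a \<otimes>\<^bsub>A\<^esub> b \<in> F (i + j)" if "1 \<le> i" "1 \<le> j" "a \<in> F i" "b \<in> F j"
    using filtration that by (simp add: descending_ideal_filtration_def)
  \<comment> \<open>The union of a descending chain is its first member, so exhaustion means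
    \<open>F 1 = carrier A\<close>.\<close>
  have "carrier A = (\<Union>i\<in>{1..}. F i)"
    using filtration by (simp add: descending_ideal_filtration_def)
  also have "\<dots> = F 1" using F_antimono[of 1] by auto
  finally show "F 1 = carrier A" by simp
qed

lemma F_smult: "\<lbrakk>1 \<le> i; k \<in> carrier K; x \<in> F i\<rbrakk> \<Longrightarrow> k \<odot>\<^bsub>A\<^esub> x \<in> F i"
  using submodule.smult_closed[OF F_submodule] .

lemma smult_minus:
  assumes "k \<in> carrier K" "x \<in> carrier A" "y \<in> carrier A"
  shows "k \<odot>\<^bsub>A\<^esub> (x \<ominus>\<^bsub>A\<^esub> y) = k \<odot>\<^bsub>A\<^esub> x \<ominus>\<^bsub>A\<^esub> k \<odot>\<^bsub>A\<^esub> y"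
  using assms by (simp add: a_minus_def smult_r_distr smult_r_minus)

lemma graded_family_smult:
  assumes "k \<in> carrier K" "graded_family f"
  shows "graded_family (\<lambda>n. k \<odot>\<^bsub>A\<^esub> f n)"
proof -
  obtain N where "\<forall>n\<ge>N. f n \<in> F (n + 1)" using assms(2) by (auto simp: graded_family_def)
  then have "\<forall>n\<ge>N. k \<odot>\<^bsub>A\<^esub> f n \<in> F (n + 1)" using F_smult assms(1) by simp
  then show ?thesis using assms F_smult unfolding graded_family_def by blast
qed

lemma convolution_smult_right:
  assumes k: "k \<in> carrier K" and f: "graded_family f" and g: "graded_family g"
  shows "convolution A f (\<lambda>n. k \<odot>\<^bsub>A\<^esub> g n) n = k \<odot>\<^bsub>A\<^esub> convolution A f g n"
proof -
  have "convolution A f (\<lambda>n. k \<odot>\<^bsub>A\<^esub> g n) n = (\<Oplus>\<^bsub>A\<^esub>i\<in>{1..<n}. k \<odot>\<^bsub>A\<^esub> (f i \<otimes>\<^bsub>A\<^esub> g (n - i)))"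
    unfolding convolution_def
    using k convolution_closed[OF f g] graded_family_carrier[OF f] graded_family_carrier[OF g]
    by (intro M.finsum_cong') (auto simp: star_smult)
  also have "\<dots> = k \<odot>\<^bsub>A\<^esub> convolution A f g n"
    unfolding convolution_def
    using k convolution_closed[OF f g]
    by (intro finsum_smult_ldistr[symmetric]) auto
  finally show ?thesis .
qed

text \<open>\<open>graded_left_homogeneous\<close> bounds the defect of each summand: the factors
  have degrees \<open>i\<close> and \<open>n - i\<close>, so it lies in \<open>F (n + 1)\<close>. In
  the right argument \<open>star_smult\<close> gives an exact equation instead.\<close>

lemma coset_convolution_smult_left:
  assumes hom: "graded_left_homogeneous K A F"
    and k: "k \<in> carrier K" and f: "graded_family f" and g: "graded_family g"
  shows "F (n + 1) +>\<^bsub>A\<^esub> convolution A (\<lambda>n. k \<odot>\<^bsub>A\<^esub> f n) g n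
    = F (n + 1) +>\<^bsub>A\<^esub> (k \<odot>\<^bsub>A\<^esub> convolution A f g n)"
proof -
  have summand: "F (n + 1) +>\<^bsub>A\<^esub> ((k \<odot>\<^bsub>A\<^esub> f i) \<otimes>\<^bsub>A\<^esub> g (n - i))
      = F (n + 1) +>\<^bsub>A\<^esub> (k \<odot>\<^bsub>A\<^esub> (f i \<otimes>\<^bsub>A\<^esub> g (n - i)))" if "i \<in> {1..<n}" for i
  proof -
    have i: "1 \<le> i" "1 \<le> n - i" and n: "i + (n - i) + 1 = n + 1" using that by auto
    have "(k \<odot>\<^bsub>A\<^esub> f i) \<otimes>\<^bsub>A\<^esub> g (n - i) \<ominus>\<^bsub>A\<^esub> (k \<odot>\<^bsub>A\<^esub> (f i \<otimes>\<^bsub>A\<^esub> g (n - i))) \<in> F (n + 1)"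
      using hom k i graded_family_mem[OF f i(1)] graded_family_mem[OF g i(2)] n
      unfolding graded_left_homogeneous_def by metis
    then show ?thesis
      using k i graded_family_carrier[OF f i(1)] graded_family_carrier[OF g i(2)]
      by (simp add: coset_eq_iff star_closed)
  qed
  have "F (n + 1) +>\<^bsub>A\<^esub> convolution A (\<lambda>n. k \<odot>\<^bsub>A\<^esub> f n) g n
    = F (n + 1) +>\<^bsub>A\<^esub> (\<Oplus>\<^bsub>A\<^esub>i\<in>{1..<n}. k \<odot>\<^bsub>A\<^esub> (f i \<otimes>\<^bsub>A\<^esub> g (n - i)))"
    unfolding convolution_def
    using k convolution_closed[OF f g] convolution_closed[OF graded_family_smult[OF k f] g] summand
    by (intro coset_finsum_cong) auto
  also have "(\<Oplus>\<^bsub>A\<^esub>i\<in>{1..<n}. k \<odot>\<^bsub>A\<^esub> (f i \<otimes>\<^bsub>A\<^esub> g (n - i))) = k \<odot>\<^bsub>A\<^esub> convolution A f g n"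
    unfolding convolution_def
    using k convolution_closed[OF f g]
    by (intro finsum_smult_ldistr[symmetric]) auto
  finally show ?thesis .
qed

section \<open>Cosets in the graded components\<close>

lemma gr_component_carrier: "carrier (gr_component A F n) = (\<lambda>a. F (n + 1) +>\<^bsub>A\<^esub> a) ` F n"
  by (auto simp: gr_component_def A_FactGroup_def FactGroup_def RCOSETS_def r_coset_def
      a_r_coset_def)

lemma gr_component_one: "\<one>\<^bsub>gr_component A F n\<^esub> = F (n + 1)"
  by (simp add: gr_component_def A_FactGroup_def FactGroup_def)

lemma gr_component_mult: "U \<otimes>\<^bsub>gr_component A F n\<^esub> V = U <+>\<^bsub>A\<^esub> V"
  by (simp add: gr_component_def A_FactGroup_def FactGroup_def set_mult_def set_add_def)

lemma gr_component_mult_coset: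
  assumes "x \<in> carrier A" "y \<in> carrier A"
  shows "(F (n + 1) +>\<^bsub>A\<^esub> x) \<otimes>\<^bsub>gr_component A F n\<^esub> (F (n + 1) +>\<^bsub>A\<^esub> y) = F (n + 1) +>\<^bsub>A\<^esub> (x \<oplus>\<^bsub>A\<^esub> y)"
  using assms by (simp add: gr_component_mult coset_add)

lemma coset_zero: "F (n + 1) +>\<^bsub>A\<^esub> \<zero>\<^bsub>A\<^esub> = F (n + 1)"
  by (simp add: coset_zero_iff F_zero)

lemma gr_component_comm_group:
  assumes n: "1 \<le> n"
  shows "comm_group (gr_component A F n)"
proof (rule comm_groupI)
  let ?G = "gr_component A F n"
  let ?c = "\<lambda>a. F (n + 1) +>\<^bsub>A\<^esub> a"
  have rep: "\<exists>a\<in>F n. a \<in> carrier A \<and> x = ?c a" if "x \<in> carrier ?G" for x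
    using that F_carrier[OF n] by (auto simp: gr_component_carrier)
  have car: "?c a \<in> carrier ?G" if "a \<in> F n" for a
    using that by (auto simp: gr_component_carrier)
  show "\<one>\<^bsub>?G\<^esub> \<in> carrier ?G"
    using car[OF F_zero[OF n]] unfolding gr_component_one coset_zero .
  show "x \<otimes>\<^bsub>?G\<^esub> y \<in> carrier ?G" "x \<otimes>\<^bsub>?G\<^esub> y = y \<otimes>\<^bsub>?G\<^esub> x"
    if x: "x \<in> carrier ?G" and y: "y \<in> carrier ?G" for x y
    using rep[OF x] rep[OF y] car F_add[OF n]
    by (auto simp: gr_component_mult_coset M.a_comm simp del: One_nat_def)
  show "x \<otimes>\<^bsub>?G\<^esub> y \<otimes>\<^bsub>?G\<^esub> z = x \<otimes>\<^bsub>?G\<^esub> (y \<otimes>\<^bsub>?G\<^esub> z)"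
    if x: "x \<in> carrier ?G" and y: "y \<in> carrier ?G" and z: "z \<in> carrier ?G" for x y z
    using rep[OF x] rep[OF y] rep[OF z]
    by (auto simp: gr_component_mult_coset M.a_assoc simp del: One_nat_def)
  fix x assume "x \<in> carrier ?G"
  then obtain a where a: "a \<in> F n" "a \<in> carrier A" "x = ?c a" using rep by blast
  show "\<one>\<^bsub>?G\<^esub> \<otimes>\<^bsub>?G\<^esub> x = x"
    using gr_component_mult_coset[of "\<zero>\<^bsub>A\<^esub>" a n] a unfolding gr_component_one coset_zero by simp
  show "\<exists>y\<in>carrier ?G. y \<otimes>\<^bsub>?G\<^esub> x = \<one>\<^bsub>?G\<^esub>"
    using a car[OF F_uminus[OF n a(1)]]
    by (intro bexI[of _ "?c (\<ominus>\<^bsub>A\<^esub> a)"])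
      (simp_all add: gr_component_mult_coset gr_component_one coset_zero M.l_neg del: One_nat_def)
qed

lemma gr_component_finprod:
  assumes n: "1 \<le> n" and "finite I" "t \<in> I \<rightarrow> F n"
  shows "finprod (gr_component A F n) (\<lambda>i. F (n + 1) +>\<^bsub>A\<^esub> t i) I = F (n + 1) +>\<^bsub>A\<^esub> finsum A t I"
proof -
  interpret G: comm_group "gr_component A F n" using n by (rule gr_component_comm_group)
  show ?thesis
    using assms(2,3)
  proof (induction I rule: finite_induct)
    case empty
    show ?case by (simp only: G.finprod_empty M.finsum_empty gr_component_one coset_zero)
  next
    case (insert i I)
    have t: "t i \<in> carrier A" "t \<in> I \<rightarrow> carrier A" "t \<in> I \<rightarrow> F n"
      using insert.prems F_carrier[OF n] by blast+
    have "finprod (gr_component A F n) (\<lambda>i. F (n + 1) +>\<^bsub>A\<^esub> t i) (insert i I)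
        = (F (n + 1) +>\<^bsub>A\<^esub> t i) \<otimes>\<^bsub>gr_component A F n\<^esub> finprod (gr_component A F n) (\<lambda>i. F (n + 1) +>\<^bsub>A\<^esub> t i) I"
      using insert by (intro G.finprod_insert) (auto simp: gr_component_carrier)
    also have "\<dots> = F (n + 1) +>\<^bsub>A\<^esub> finsum A t (insert i I)"
      unfolding insert.IH[OF t(3)] using t insert(1,2)
      by (simp add: gr_component_mult_coset M.finsum_insert del: One_nat_def)
    finally show ?case .
  qed
qed

text \<open>By \<open>coset_star_cong\<close> all cosets in the union defining
  \<open>rcoset_mult\<close> coincide, and the union is not empty because \<open>a\<close> and
  \<open>b\<close> represent their own cosets.\<close>

lemma rcoset_mult_coset:
  assumes i: "1 \<le> i" "1 \<le> j" and a: "a \<in> F i" and b: "b \<in> F j"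
  shows "rcoset_mult A (F (i + j + 1)) (F (i + 1) +>\<^bsub>A\<^esub> a) (F (j + 1) +>\<^bsub>A\<^esub> b)
    = F (i + j + 1) +>\<^bsub>A\<^esub> (a \<otimes>\<^bsub>A\<^esub> b)"
proof -
  \<comment> \<open>\<open>coset_star_cong\<close> requires the other representatives to have the
    same degree; they do, since \<open>F (i + 1)\<close> is contained in \<open>F i\<close>.\<close>
  have *: "a' \<in> F i \<and> F (i + 1) +>\<^bsub>A\<^esub> a' = F (i + 1) +>\<^bsub>A\<^esub> a"
    if i: "1 \<le> i" and a: "a \<in> F i" and a': "a' \<in> F (i + 1) +>\<^bsub>A\<^esub> a" for i a a'
  proof -
    interpret S: abelian_subgroup "F (i + 1)" A by (rule F_abelian_subgroup) simp
    have ac: "a \<in> carrier A" using i a F_carrier by blast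
    obtain h where "h \<in> F (i + 1)" "a' = h \<oplus>\<^bsub>A\<^esub> a"
      using a' unfolding a_r_coset_def' by blast
    then have "a' \<in> F i" using i a F_mono[of h "i + 1" i] by (simp add: F_add)
    then show ?thesis using S.a_repr_independence'[OF a' ac] by simp
  qed
  have "F (i + j + 1) +>\<^bsub>A\<^esub> (a' \<otimes>\<^bsub>A\<^esub> b') = F (i + j + 1) +>\<^bsub>A\<^esub> (a \<otimes>\<^bsub>A\<^esub> b)"
    if "a' \<in> F (i + 1) +>\<^bsub>A\<^esub> a" "b' \<in> F (j + 1) +>\<^bsub>A\<^esub> b" for a' b'
    using *[OF i(1) a that(1)] *[OF i(2) b that(2)] i a b by (intro coset_star_cong) auto
  moreover have "a \<in> F (i + 1) +>\<^bsub>A\<^esub> a" "b \<in> F (j + 1) +>\<^bsub>A\<^esub> b"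
    using abelian_subgroup.a_rcos_self[OF F_abelian_subgroup] F_carrier i a b by simp_all
  ultimately show ?thesis unfolding rcoset_mult_def by blast
qed

text \<open>Another union of equal cosets: two representatives differ by an element of
  \<open>F (n + 1)\<close>, which is closed under scalars.\<close>

lemma smult_coset:
  assumes k: "k \<in> carrier K" and a: "a \<in> carrier A"
  shows "(\<Union>x\<in>F (n + 1) +>\<^bsub>A\<^esub> a. F (n + 1) +>\<^bsub>A\<^esub> (k \<odot>\<^bsub>A\<^esub> x)) = F (n + 1) +>\<^bsub>A\<^esub> (k \<odot>\<^bsub>A\<^esub> a)"
proof -
  interpret S: abelian_subgroup "F (n + 1)" A by (rule F_abelian_subgroup) simp
  have "F (n + 1) +>\<^bsub>A\<^esub> (k \<odot>\<^bsub>A\<^esub> x) = F (n + 1) +>\<^bsub>A\<^esub> (k \<odot>\<^bsub>A\<^esub> a)" if x: "x \<in> F (n + 1) +>\<^bsub>A\<^esub> a" for x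
  proof -
    have xc: "x \<in> carrier A" using S.a_elemrcos_carrier[OF a x] .
    have "x \<ominus>\<^bsub>A\<^esub> a \<in> F (n + 1)" using S.a_repr_independence'[OF x a, symmetric] xc a coset_eq_iff by simp
    then have "k \<odot>\<^bsub>A\<^esub> x \<ominus>\<^bsub>A\<^esub> k \<odot>\<^bsub>A\<^esub> a \<in> F (n + 1)"
      using F_smult[of "n + 1" k "x \<ominus>\<^bsub>A\<^esub> a"] k a xc by (simp add: smult_minus)
    then show ?thesis using k a xc coset_eq_iff by simp
  qed
  moreover have "a \<in> F (n + 1) +>\<^bsub>A\<^esub> a" using S.a_rcos_self[OF a] .
  ultimately show ?thesis by blast
qed

section \<open>Elements of the graded structure as classes of families\<close>

text \<open>Restricted to positive degrees because the carrier of the direct sum consists of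
  functions that are extensional on \<open>{1..}\<close>.\<close>

definition gr_class :: "(nat \<Rightarrow> 'c) \<Rightarrow> nat \<Rightarrow> 'c set" where
  "gr_class f = (\<lambda>n\<in>{1..}. F (n + 1) +>\<^bsub>A\<^esub> f n)"

lemma gr_class_eqI:
  assumes "\<And>n. 1 \<le> n \<Longrightarrow> F (n + 1) +>\<^bsub>A\<^esub> f n = F (n + 1) +>\<^bsub>A\<^esub> g n"
  shows "gr_class f = gr_class g"
  using assms by (auto simp: gr_class_def restrict_def fun_eq_iff)

text \<open>Reduces computation in \<open>gr A F\<close> to families in \<open>A\<close>. The finite
  support of a direct sum element matches the tail condition of \<open>graded_family\<close>, as
  \<open>F (n + 1)\<close> is the zero of the component.\<close>

lemma gr_carrier: "carrier (gr A F) = gr_class ` {f. graded_family f}"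
proof -
  have grp: "group (gr_component A F n)" if "n \<in> {1..}" for n
    using gr_component_comm_group that by (simp add: comm_group_def)
  have car: "carrier (gr A F) = {x \<in> \<Pi>\<^sub>E n\<in>{1..}. carrier (gr_component A F n).
      finite {n \<in> {1..}. x n \<noteq> F (n + 1)}}"
    using carrier_sum_group[of "{1..}" "gr_component A F", OF grp]
    by (simp add: gr_def Let_def gr_component_one)
  show ?thesis
  proof (intro equalityI subsetI)
    fix x assume "x \<in> carrier (gr A F)"
    then have x: "x \<in> (\<Pi>\<^sub>E n\<in>{1..}. carrier (gr_component A F n))"
      and fin: "finite {n \<in> {1..}. x n \<noteq> F (n + 1)}" by (auto simp: car)
    have "\<forall>n. \<exists>a. 1 \<le> n \<longrightarrow> a \<in> F n \<and> x n = F (n + 1) +>\<^bsub>A\<^esub> a"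
      using PiE_mem[OF x] by (auto simp: gr_component_carrier)
    then obtain f where f: "\<And>n. 1 \<le> n \<Longrightarrow> f n \<in> F n \<and> x n = F (n + 1) +>\<^bsub>A\<^esub> f n" by metis
    \<comment> \<open>Beyond a bound \<open>N\<close> of the support the coset of \<open>f n\<close>
      is zero, which places \<open>f n\<close> itself in \<open>F (n + 1)\<close>.\<close>
    obtain N where N: "\<forall>n\<in>{n \<in> {1..}. x n \<noteq> F (n + 1)}. n \<le> N"
      using fin finite_nat_set_iff_bounded_le by blast
    have "f n \<in> F (n + 1)" if "N + 1 \<le> n" for n
    proof -
      have "x n = F (n + 1)" using N that by (metis (mono_tags, lifting) Suc_eq_plus1 atLeast_iff le_add2 mem_Collect_eq not_less_eq_eq order_trans)
      then show ?thesis using f[of n] F_carrier[of n "f n"] that by (simp add: coset_zero_iff)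
    qed
    then have "graded_family f" using f unfolding graded_family_def by blast
    moreover have "x = gr_class f"
      using f PiE_arb[OF x] by (auto simp: gr_class_def fun_eq_iff restrict_def)
    ultimately show "x \<in> gr_class ` {f. graded_family f}" by blast
  next
    fix x assume "x \<in> gr_class ` {f. graded_family f}"
    then obtain f where x: "x = gr_class f" and f: "graded_family f" by blast
    obtain N where N: "\<forall>n\<ge>N. f n \<in> F (n + 1)" using f by (auto simp: graded_family_def)
    have "{n \<in> {1..}. x n \<noteq> F (n + 1)} \<subseteq> {..<N}"
      using N graded_family_carrier[OF f] coset_zero_iff
      by (force simp: x gr_class_def not_le[symmetric])
    then have "finite {n \<in> {1..}. x n \<noteq> F (n + 1)}" by (rule finite_subset) simp
    then show "x \<in> carrier (gr A F)"
      using graded_family_mem[OF f] by (auto simp: car x gr_class_def gr_component_carrier)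
  qed
qed

lemma gr_class_closed: "graded_family f \<Longrightarrow> gr_class f \<in> carrier (gr A F)"
  by (simp add: gr_carrier)

lemma gr_carrierE:
  assumes "x \<in> carrier (gr A F)"
  obtains f where "graded_family f" "x = gr_class f"
  using assms gr_carrier by blast

lemma gr_add:
  assumes "graded_family f" "graded_family g"
  shows "gr_class f \<oplus>\<^bsub>gr A F\<^esub> gr_class g = gr_class (\<lambda>n. f n \<oplus>\<^bsub>A\<^esub> g n)"
  using graded_family_carrier[OF assms(1)] graded_family_carrier[OF assms(2)]
  by (auto simp: gr_def Let_def gr_class_def fun_eq_iff restrict_def gr_component_mult coset_add)

lemma gr_zero: "\<zero>\<^bsub>gr A F\<^esub> = gr_class (\<lambda>n. \<zero>\<^bsub>A\<^esub>)"
  using coset_zero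
  by (auto simp: gr_def Let_def gr_class_def fun_eq_iff restrict_def gr_component_one)

lemma gr_smult:
  assumes "k \<in> carrier K" "graded_family f"
  shows "k \<odot>\<^bsub>gr A F\<^esub> gr_class f = gr_class (\<lambda>n. k \<odot>\<^bsub>A\<^esub> f n)"
  using smult_coset[OF assms(1)] graded_family_carrier[OF assms(2)]
  by (auto simp: gr_def Let_def gr_class_def fun_eq_iff restrict_def)

text \<open>In degree \<open>n\<close> each \<open>rcoset_mult\<close> becomes the coset of a
  product by \<open>rcoset_mult_coset\<close>, the degrees \<open>i\<close> and \<open>n - i\<close>
  giving the modulus \<open>F (n + 1)\<close>; \<open>gr_component_finprod\<close> then adds these
  cosets.\<close>

lemma gr_mult:
  assumes f: "graded_family f" and g: "graded_family g"
  shows "gr_class f \<otimes>\<^bsub>gr A F\<^esub> gr_class g = gr_class (convolution A f g)"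
proof -
  have "finprod (gr_component A F n)
      (\<lambda>i. rcoset_mult A (F (n + 1)) (gr_class f i) (gr_class g (n - i))) {1..<n}
    = F (n + 1) +>\<^bsub>A\<^esub> convolution A f g n" if n: "1 \<le> n" for n
  proof -
    interpret G: comm_group "gr_component A F n" using n by (rule gr_component_comm_group)
    have "rcoset_mult A (F (n + 1)) (gr_class f i) (gr_class g (n - i))
        = F (n + 1) +>\<^bsub>A\<^esub> (f i \<otimes>\<^bsub>A\<^esub> g (n - i))" if i: "i \<in> {1..<n}" for i
    proof -
      have pos: "1 \<le> i" "1 \<le> n - i" and n: "i + (n - i) = n" using i by auto
      then show ?thesis
        using rcoset_mult_coset[OF pos graded_family_mem[OF f pos(1)] graded_family_mem[OF g pos(2)]]
        by (simp add: gr_class_def)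
    qed
    then have "finprod (gr_component A F n)
        (\<lambda>i. rcoset_mult A (F (n + 1)) (gr_class f i) (gr_class g (n - i))) {1..<n}
      = finprod (gr_component A F n) (\<lambda>i. F (n + 1) +>\<^bsub>A\<^esub> (f i \<otimes>\<^bsub>A\<^esub> g (n - i))) {1..<n}"
      using convolution_summand[OF f g]
      by (intro G.finprod_cong') (auto simp: gr_component_carrier)
    also have "\<dots> = F (n + 1) +>\<^bsub>A\<^esub> convolution A f g n"
      unfolding convolution_def using convolution_summand[OF f g] n
      by (intro gr_component_finprod) auto
    finally show ?thesis .
  qed
  then show ?thesis
    by (auto simp: gr_def Let_def gr_class_def[of "convolution A f g"] fun_eq_iff restrict_def)
qed

section \<open>The module and pre-Lie axioms\<close>

text \<open>Each axiom is checked on representing families, where it is the corresponding axiom of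
  \<open>A\<close> in every degree.\<close>

lemma gr_abelian_group: "abelian_group (gr A F)"
proof (rule abelian_groupI)
  let ?L = "gr A F"
  show "x \<oplus>\<^bsub>?L\<^esub> y \<in> carrier ?L" "x \<oplus>\<^bsub>?L\<^esub> y = y \<oplus>\<^bsub>?L\<^esub> x"
    if "x \<in> carrier ?L" "y \<in> carrier ?L" for x y
    using that
    by (auto elim!: gr_carrierE simp: gr_add graded_family_add gr_class_closed
        graded_family_carrier M.a_comm intro!: gr_class_eqI)
  show "\<zero>\<^bsub>?L\<^esub> \<in> carrier ?L" by (simp add: gr_zero gr_class_closed graded_family_zero)
  show "(x \<oplus>\<^bsub>?L\<^esub> y) \<oplus>\<^bsub>?L\<^esub> z = x \<oplus>\<^bsub>?L\<^esub> (y \<oplus>\<^bsub>?L\<^esub> z)"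
    if "x \<in> carrier ?L" "y \<in> carrier ?L" "z \<in> carrier ?L" for x y z
    using that
    by (auto elim!: gr_carrierE simp: gr_add graded_family_add
        graded_family_carrier M.a_assoc intro!: gr_class_eqI)
  show "\<zero>\<^bsub>?L\<^esub> \<oplus>\<^bsub>?L\<^esub> x = x" if "x \<in> carrier ?L" for x
    using that
    by (auto elim!: gr_carrierE simp: gr_zero gr_add graded_family_zero
        graded_family_carrier intro!: gr_class_eqI)
  show "\<exists>y\<in>carrier ?L. y \<oplus>\<^bsub>?L\<^esub> x = \<zero>\<^bsub>?L\<^esub>" if "x \<in> carrier ?L" for x
  proof -
    obtain f where f: "graded_family f" "x = gr_class f" using gr_carrierE \<open>x \<in> carrier ?L\<close> .
    have "gr_class (\<lambda>n. \<ominus>\<^bsub>A\<^esub> f n) \<oplus>\<^bsub>?L\<^esub> x = \<zero>\<^bsub>?L\<^esub>"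
      using f graded_family_uminus[OF f(1)]
      by (auto simp: gr_add gr_zero graded_family_carrier M.l_neg intro!: gr_class_eqI)
    then show ?thesis using gr_class_closed[OF graded_family_uminus[OF f(1)]] by blast
  qed
qed

lemma gr_module: "module K (gr A F)"
proof (intro module.intro module_axioms.intro gr_abelian_group is_cring)
  let ?L = "gr A F"
  fix k l x
  assume k: "k \<in> carrier K" and "x \<in> carrier ?L"
  then obtain f where f: "graded_family f" and x: "x = gr_class f" using gr_carrierE by blast
  show "k \<odot>\<^bsub>?L\<^esub> x \<in> carrier ?L"
    using k f x by (simp add: gr_smult gr_class_closed graded_family_smult)
  show "k \<odot>\<^bsub>?L\<^esub> (x \<oplus>\<^bsub>?L\<^esub> y) = k \<odot>\<^bsub>?L\<^esub> x \<oplus>\<^bsub>?L\<^esub> k \<odot>\<^bsub>?L\<^esub> y" if "y \<in> carrier ?L" for y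
    using that k f x
    by (auto elim!: gr_carrierE simp: gr_add gr_smult graded_family_smult graded_family_add
        graded_family_carrier smult_r_distr intro!: gr_class_eqI)
  assume l: "l \<in> carrier K"
  show "(k \<oplus>\<^bsub>K\<^esub> l) \<odot>\<^bsub>?L\<^esub> x = k \<odot>\<^bsub>?L\<^esub> x \<oplus>\<^bsub>?L\<^esub> l \<odot>\<^bsub>?L\<^esub> x"
    using k l f x
    by (auto simp: gr_add gr_smult graded_family_smult graded_family_carrier smult_l_distr
        intro!: gr_class_eqI)
  show "(k \<otimes>\<^bsub>K\<^esub> l) \<odot>\<^bsub>?L\<^esub> x = k \<odot>\<^bsub>?L\<^esub> (l \<odot>\<^bsub>?L\<^esub> x)"
    using k l f x
    by (auto simp: gr_smult graded_family_smult graded_family_carrier smult_assoc1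
        intro!: gr_class_eqI)
next
  fix x assume "x \<in> carrier (gr A F)"
  then show "\<one>\<^bsub>K\<^esub> \<odot>\<^bsub>gr A F\<^esub> x = x"
    by (auto elim!: gr_carrierE simp: gr_smult graded_family_carrier intro!: gr_class_eqI)
qed

lemma gr_associator:
  assumes "a \<in> carrier (gr A F)" "b \<in> carrier (gr A F)" "c \<in> carrier (gr A F)"
  shows "associator (gr A F) a b c = associator (gr A F) b a c"
proof -
  interpret L: abelian_group "gr A F" by (rule gr_abelian_group)
  obtain f where f: "graded_family f" "a = gr_class f" using assms(1) by (rule gr_carrierE)
  obtain g where g: "graded_family g" "b = gr_class g" using assms(2) by (rule gr_carrierE)
  obtain h where h: "graded_family h" "c = gr_class h" using assms(3) by (rule gr_carrierE)
  note fgh = f(1) g(1) h(1) and abc = f(2) g(2) h(2)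
  note conv = graded_family_convolution[OF fgh(1,2)] graded_family_convolution[OF fgh(2,1)]
    graded_family_convolution[OF fgh(1,3)] graded_family_convolution[OF fgh(2,3)]
  show ?thesis
    unfolding associator_def
  proof (rule L.minus_eq_minusI)
    show "a \<otimes>\<^bsub>gr A F\<^esub> b \<otimes>\<^bsub>gr A F\<^esub> c \<oplus>\<^bsub>gr A F\<^esub> b \<otimes>\<^bsub>gr A F\<^esub> (a \<otimes>\<^bsub>gr A F\<^esub> c)
      = b \<otimes>\<^bsub>gr A F\<^esub> a \<otimes>\<^bsub>gr A F\<^esub> c \<oplus>\<^bsub>gr A F\<^esub> a \<otimes>\<^bsub>gr A F\<^esub> (b \<otimes>\<^bsub>gr A F\<^esub> c)"
      using fgh conv
      by (simp add: abc gr_mult gr_add graded_family_convolution)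
        (rule gr_class_eqI, rule coset_convolution_associator[OF fgh])
  qed (use fgh conv in \<open>simp_all add: abc gr_mult graded_family_convolution gr_class_closed\<close>)
qed

lemma gr_right_linear_pre_lie_algebra: "right_linear_pre_lie_algebra K (gr A F)"
proof (intro right_linear_pre_lie_algebra.intro right_linear_pre_lie_algebra_axioms.intro
    gr_module field_axioms)
  let ?L = "gr A F"
  fix a b c assume a: "a \<in> carrier ?L" and b: "b \<in> carrier ?L"
  obtain f where f: "graded_family f" "a = gr_class f" using a by (rule gr_carrierE)
  obtain g where g: "graded_family g" "b = gr_class g" using b by (rule gr_carrierE)
  note fg = f(1) g(1) f(2) g(2)
  show "a \<otimes>\<^bsub>?L\<^esub> b \<in> carrier ?L"
    using fg by (simp add: gr_mult gr_class_closed graded_family_convolution)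
  show "a \<otimes>\<^bsub>?L\<^esub> (k \<odot>\<^bsub>?L\<^esub> b) = k \<odot>\<^bsub>?L\<^esub> (a \<otimes>\<^bsub>?L\<^esub> b)" if "k \<in> carrier K" for k
    using fg that
    by (simp add: gr_mult gr_smult graded_family_convolution graded_family_smult)
      (simp only: convolution_smult_right[OF that fg(1,2), abs_def])
  assume c: "c \<in> carrier ?L"
  obtain h where h: "graded_family h" "c = gr_class h" using c by (rule gr_carrierE)
  show "a \<otimes>\<^bsub>?L\<^esub> (b \<oplus>\<^bsub>?L\<^esub> c) = a \<otimes>\<^bsub>?L\<^esub> b \<oplus>\<^bsub>?L\<^esub> a \<otimes>\<^bsub>?L\<^esub> c"
    using fg h
    by (simp add: gr_mult gr_add graded_family_convolution graded_family_add)
      (simp only: convolution_add_right[OF fg(1,2) h(1), abs_def])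
  show "(a \<oplus>\<^bsub>?L\<^esub> b) \<otimes>\<^bsub>?L\<^esub> c = a \<otimes>\<^bsub>?L\<^esub> c \<oplus>\<^bsub>?L\<^esub> b \<otimes>\<^bsub>?L\<^esub> c"
    using fg h
    by (simp add: gr_mult gr_add graded_family_convolution graded_family_add)
      (rule gr_class_eqI, rule coset_convolution_add_left[OF fg(1,2) h(1)])
  show "associator ?L a b c = associator ?L b a c" using a b c by (rule gr_associator)
qed

section \<open>Homogeneous elements and linearity in the first argument\<close>

lemma gr_hom_eq_class:
  "gr_hom A F i a = gr_class (\<lambda>n. if n = i then a else \<zero>\<^bsub>A\<^esub>)"
  using coset_zero by (auto simp: gr_hom_def gr_class_def fun_eq_iff restrict_def)

lemma gr_hom_closed: "\<lbrakk>1 \<le> i; a \<in> F i\<rbrakk> \<Longrightarrow> gr_hom A F i a \<in> carrier (gr A F)"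
  by (simp add: gr_hom_eq_class gr_class_closed graded_family_single)

lemma gr_hom_mult:
  assumes i: "1 \<le> i" "1 \<le> j" and a: "a \<in> F i" and b: "b \<in> F j"
  shows "gr_hom A F i a \<otimes>\<^bsub>gr A F\<^esub> gr_hom A F j b = gr_hom A F (i + j) (a \<otimes>\<^bsub>A\<^esub> b)"
proof -
  let ?f = "\<lambda>n. if n = i then a else \<zero>\<^bsub>A\<^esub>" and ?g = "\<lambda>n. if n = j then b else \<zero>\<^bsub>A\<^esub>"
  have car: "a \<in> carrier A" "b \<in> carrier A" using assms F_carrier by blast+
  have "convolution A ?f ?g n = (if n = i + j then a \<otimes>\<^bsub>A\<^esub> b else \<zero>\<^bsub>A\<^esub>)" for n
  proof -
    \<comment> \<open>Only the summand \<open>p = i\<close> can survive, and it does so exactly when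
      \<open>n - i = j\<close>.\<close>
    have "convolution A ?f ?g n
        = (\<Oplus>\<^bsub>A\<^esub>p\<in>{1..<n}. if i = p then (if n = i + j then a \<otimes>\<^bsub>A\<^esub> b else \<zero>\<^bsub>A\<^esub>) else \<zero>\<^bsub>A\<^esub>)"
      unfolding convolution_def using car
      by (intro M.finsum_cong') (auto simp: star_closed zero_star star_zero_right)
    also have "\<dots> = (if n = i + j then a \<otimes>\<^bsub>A\<^esub> b else \<zero>\<^bsub>A\<^esub>)"
    proof (cases "n = i + j")
      case True
      then show ?thesis
        using M.finsum_singleton[of i "{1..<n}" "\<lambda>p. a \<otimes>\<^bsub>A\<^esub> b"] i car by (simp add: star_closed)
    next
      case False
      then show ?thesis by (simp add: M.finsum_zero)
    qed
    finally show ?thesis .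
  qed
  then have "convolution A ?f ?g = (\<lambda>n. if n = i + j then a \<otimes>\<^bsub>A\<^esub> b else \<zero>\<^bsub>A\<^esub>)" by (rule ext)
  then show ?thesis
    using assms by (simp add: gr_hom_eq_class gr_mult graded_family_single)
qed

lemma gr_hom_smult:
  assumes "1 \<le> i" "a \<in> F i" "k \<in> carrier K"
  shows "k \<odot>\<^bsub>gr A F\<^esub> gr_hom A F i a = gr_hom A F i (k \<odot>\<^bsub>A\<^esub> a)"
  using assms
  by (auto simp: gr_hom_eq_class gr_smult graded_family_single smult_r_null intro!: gr_class_eqI)

text \<open>Translates an equation between homogeneous elements of \<open>gr A F\<close> back into a
  membership in the filtration.\<close>

lemma gr_hom_eq_iff:
  assumes "1 \<le> i" "a \<in> carrier A" "b \<in> carrier A"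
  shows "gr_hom A F i a = gr_hom A F i b \<longleftrightarrow> a \<ominus>\<^bsub>A\<^esub> b \<in> F (i + 1)"
proof -
  have "gr_hom A F i a = gr_hom A F i b \<longleftrightarrow> F (i + 1) +>\<^bsub>A\<^esub> a = F (i + 1) +>\<^bsub>A\<^esub> b"
    using assms(1) by (auto simp: gr_hom_def fun_eq_iff restrict_def)
  then show ?thesis using assms by (simp add: coset_eq_iff)
qed

text \<open>Tested on homogeneous elements, linearity in the first argument is precisely the stated
  membership. Conversely, the membership gives the congruence of convolutions in every
  degree.\<close>

lemma gr_pre_lie_algebra_iff: "pre_lie_algebra K (gr A F) \<longleftrightarrow> graded_left_homogeneous K A F"
proof
  let ?L = "gr A F"
  assume "pre_lie_algebra K ?L"
  then interpret L: pre_lie_algebra K ?L .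
  show "graded_left_homogeneous K A F"
    unfolding graded_left_homogeneous_def
  proof (intro ballI allI impI)
    fix k i j a b
    assume k: "k \<in> carrier K" and i: "1 \<le> i" "1 \<le> j" and ab: "a \<in> F i" "b \<in> F j"
    \<comment> \<open>Both sides of the linearity law are computed as homogeneous elements of degree
      \<open>i + j\<close>; their equality says that the representatives differ by an element of
      \<open>F (i + j + 1)\<close>.\<close>
    have "gr_hom A F (i + j) ((k \<odot>\<^bsub>A\<^esub> a) \<otimes>\<^bsub>A\<^esub> b) = (k \<odot>\<^bsub>?L\<^esub> gr_hom A F i a) \<otimes>\<^bsub>?L\<^esub> gr_hom A F j b"
      using k i ab by (simp add: gr_hom_smult gr_hom_mult F_smult)
    also have "\<dots> = k \<odot>\<^bsub>?L\<^esub> (gr_hom A F i a \<otimes>\<^bsub>?L\<^esub> gr_hom A F j b)"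
      using L.prod_smult_left k gr_hom_closed i ab by blast
    also have "\<dots> = gr_hom A F (i + j) (k \<odot>\<^bsub>A\<^esub> (a \<otimes>\<^bsub>A\<^esub> b))"
      using k i ab by (simp add: gr_hom_smult gr_hom_mult F_star)
    finally show "(k \<odot>\<^bsub>A\<^esub> a) \<otimes>\<^bsub>A\<^esub> b \<ominus>\<^bsub>A\<^esub> (k \<odot>\<^bsub>A\<^esub> (a \<otimes>\<^bsub>A\<^esub> b)) \<in> F (i + j + 1)"
      using gr_hom_eq_iff[of "i + j"] k i F_carrier[OF i(1) ab(1)] F_carrier[OF i(2) ab(2)]
      by (simp add: star_closed)
  qed
next
  assume hom: "graded_left_homogeneous K A F"
  show "pre_lie_algebra K (gr A F)"
  proof (intro pre_lie_algebra.intro pre_lie_algebra_axioms.intro gr_right_linear_pre_lie_algebra)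
    fix k a b
    assume k: "k \<in> carrier K" and a: "a \<in> carrier (gr A F)" and b: "b \<in> carrier (gr A F)"
    obtain f where f: "graded_family f" "a = gr_class f" using a by (rule gr_carrierE)
    obtain g where g: "graded_family g" "b = gr_class g" using b by (rule gr_carrierE)
    show "(k \<odot>\<^bsub>gr A F\<^esub> a) \<otimes>\<^bsub>gr A F\<^esub> b = k \<odot>\<^bsub>gr A F\<^esub> (a \<otimes>\<^bsub>gr A F\<^esub> b)"
      using k f g
      by (simp add: gr_mult gr_smult graded_family_convolution graded_family_smult)
        (rule gr_class_eqI, rule coset_convolution_smult_left[OF hom k f(1) g(1)])
  qed
qed

end

theorem theorem5:
  fixes K :: "('k, 'm) ring_scheme"
    and A :: "('k, 'a, 'n) module_scheme"
    and F :: "nat \<Rightarrow> 'a set"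
  assumes "K_brace K A"
    and "descending_ideal_filtration K A F"
  shows "right_linear_pre_lie_algebra K (gr A F)
    \<and> (pre_lie_algebra K (gr A F) \<longleftrightarrow> graded_left_homogeneous K A F)
    \<and> (\<forall>i\<ge>1. \<forall>j\<ge>1. \<forall>a\<in>F i. \<forall>b\<in>F j.
         gr_hom A F i a \<in> carrier (gr A F) \<and>
         gr_hom A F i a \<otimes>\<^bsub>gr A F\<^esub> gr_hom A F j b = gr_hom A F (i + j) (a \<otimes>\<^bsub>A\<^esub> b))"
proof -
  interpret filtered_K_brace K A F
    using assms by (simp add: filtered_K_brace_def filtered_K_brace_axioms_def)
  show ?thesis
    using gr_right_linear_pre_lie_algebra gr_pre_lie_algebra_iff gr_hom_closed gr_hom_mult
    by blast
qed

end
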